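(* Let $d\ge 1$ be an integer, $0<p<\infty$, $H\in(0,1]$, $\eta\in\mathbb{R}$ and $\kappa\in(0,1)$. Let $D\subsetneq\mathbb{R}^d$, $D\neq\emptyset$, be a proper $\kappa$-plump open set, and let $\phi:(0,\infty)\to(0,\infty)$ be a (measurable) function such that at least one of the following conditions holds: (T) $\overline{\mathrm{dim}}_A(\partial D)<d-\eta$, $D$ is unbounded, and $\phi\in \mathrm{WUSC}(\eta,0,H^{-1})$; (F) $\underline{\mathrm{dim}}_A(\partial D)>d-\eta$, $D$ is bounded or $\partial D$ is unbounded, and $\phi\in \mathrm{WLSC}(\eta,0,H)$. Then there exist constants $c,R>0$ such that $$\int_D \frac{|u(x)|^p}{\phi(\delta_x)}\,dx \le c\int_D\int_{D\cap B(x,R\delta_x)} \frac{|u(x)-u(y)|^p}{\phi(\delta_x)\,\delta_x^d}\,dy\,dx$$ for all measurable functions $u$ on $D$ for which the left-hand side is finite.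
   Context: $\mathbb{R}^d$ carries the Euclidean distance and Lebesgue measure. $B(x,r)$ is the open ball, $\bar B(x,r)$ the closed ball, and $\delta_x=\mathrm{dist}(x,\mathbb{R}^d\setminus D)$. Diameters may be $+\infty$. Plumpness: a set $A\subset\mathbb{R}^d$ is $\kappa$-plump with $\kappa\in(0,1)$ if for each $0<r<\mathrm{diam}(A)$ and each $x\in\overline{A}$ there is $z\in\bar B(x,r)$ with $B(z,\kappa r)\subset A$. Assouad dimensions of $\emptyset\ne E\subset\mathbb{R}^d$: the lower Assouad dimension $\underline{\mathrm{dim}}_A(E)$ is the supremum of all $\lambda\ge0$ for which there is $C>0$ such that, whenever $0<r<R<2\,\mathrm{diam}(E)$ and $x\in E$, at least $C(R/r)^\lambda$ balls centred in $E$ and of radius $r$ are needed to cover $B(x,R)\cap E$. The upper Assouad dimension $\overline{\mathrm{dim}}_A(E)$ is the infimum of all $\lambda\ge0$ for which there is $C>0$ such that, whenever $0<r<R<2\,\mathrm{diam}(E)$ and $x\in E$, the set $E\cap B(x,R)$ can be covered by at most $C(R/r)^\lambda$ balls centred in $E$ and of radius $r$. Scaling classes: for $\eta\in\mathbb{R}$, $H\in(0,1]$ and $\phi:(0,\infty)\to(0,\infty)$, write $\phi\in\mathrm{WLSC}(\eta,0,H)$ if $\phi(st)\ge H t^\eta\phi(s)$ for all $s>0$ and all $t\ge1$; write $\phi\in\mathrm{WUSC}(\eta,0,H^{-1})$ if $\phi(st)\ge Ht^\eta\phi(s)$ for all $s>0$ and all $t\in(0,1]$. *)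

theory Defs
  imports "HOL-Analysis.Analysis"
begin

(* The library's diameter is real-valued and carries no information on unbounded sets. *)
definition ediam :: "'a::metric_space set \<Rightarrow> ennreal" where
  "ediam S = (SUP x\<in>S. SUP y\<in>S. ennreal (dist x y))"

definition plump :: "real \<Rightarrow> 'a::metric_space set \<Rightarrow> bool" where
  "plump \<kappa> A \<longleftrightarrow>
    (\<forall>r>0. ennreal r < ediam A \<longrightarrow>
      (\<forall>x\<in>closure A. \<exists>z\<in>cball x r. ball z (\<kappa> * r) \<subseteq> A))"

(* A cover by open balls of radius r centred in E is represented by its set F of centres. *)
definition ball_cover :: "'a::metric_space set \<Rightarrow> real \<Rightarrow> 'a set \<Rightarrow> 'a set \<Rightarrow> bool" where
  "ball_cover E r S F \<longleftrightarrow> F \<subseteq> E \<and> S \<subseteq> (\<Union>y\<in>F. ball y r)"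

(* Only finite covers are constrained: an infinite cover uses more balls than any real bound. *)
definition lower_Assouad_dim :: "'a::metric_space set \<Rightarrow> ereal" where
  "lower_Assouad_dim E =
    Sup {ereal a | a. 0 \<le> a \<and>
      (\<exists>C>0. \<forall>r R. \<forall>x\<in>E. 0 < r \<and> r < R \<and> ennreal R < 2 * ediam E \<longrightarrow>
        (\<forall>F. finite F \<and> ball_cover E r (ball x R \<inter> E) F \<longrightarrow>
          C * (R / r) powr a \<le> real (card F)))}"

definition upper_Assouad_dim :: "'a::metric_space set \<Rightarrow> ereal" where
  "upper_Assouad_dim E =
    Inf {ereal a | a. 0 \<le> a \<and>
      (\<exists>C>0. \<forall>r R. \<forall>x\<in>E. 0 < r \<and> r < R \<and> ennreal R < 2 * ediam E \<longrightarrow>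
        (\<exists>F. finite F \<and> ball_cover E r (ball x R \<inter> E) F \<and>
          real (card F) \<le> C * (R / r) powr a))}"

(* The global scaling classes WLSC(eta, 0, H) and WUSC(eta, 0, K). By convention the third
   parameter of WUSC is the reciprocal of the constant in the inequality. *)
definition WLSC :: "real \<Rightarrow> real \<Rightarrow> (real \<Rightarrow> real) \<Rightarrow> bool" where
  "WLSC \<eta> H \<phi> \<longleftrightarrow> (\<forall>s>0. \<forall>t\<ge>1. \<phi> (s * t) \<ge> H * t powr \<eta> * \<phi> s)"

definition WUSC :: "real \<Rightarrow> real \<Rightarrow> (real \<Rightarrow> real) \<Rightarrow> bool" where
  "WUSC \<eta> K \<phi> \<longleftrightarrow> (\<forall>s>0. \<forall>t\<in>{0<..1}. \<phi> (s * t) \<ge> inverse K * t powr \<eta> * \<phi> s)"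

definition bdry_dist :: "'a::metric_space set \<Rightarrow> 'a \<Rightarrow> real" where
  "bdry_dist D x = infdist x (- D)"

end

theory Submission
  imports Defs
begin

text \<open>
  Write \<open>\<rho>\<close> for the distance of \<open>x\<close> to the boundary and \<open>n\<close> for the dimension. Each \<open>x\<close> is paired with
  points \<open>y\<close> of the domain that lie within a multiple of \<open>\<rho>\<close> of \<open>x\<close>, but whose distance to the boundary
  is of another order: about \<open>\<epsilon> * \<rho>\<close> if the boundary is thick, about \<open>\<rho> / \<epsilon>\<close> if it is thin. Averaging
  \<open>\<bar>u x\<bar> powr p \<le> 2 powr p * (\<bar>u y\<bar> powr p + \<bar>u x - u y\<bar> powr p)\<close> over the partners \<open>y\<close> of \<open>x\<close>, multiplying
  by the weight \<open>1 / \<phi> \<rho>\<close> and integrating in \<open>x\<close> bounds the left-hand side by the right-hand side plus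
  a term in \<open>\<bar>u y\<bar> powr p\<close>. By Tonelli's theorem that term is the left-hand side again, times a factor
  that measures how much weight is transported to \<open>y\<close>. If the factor is at most one half, the term is
  absorbed, because the left-hand side is finite
  (\<open>nn_integral_le_differences_by_absorption\<close>).

  The factor is small because the dimension of the boundary makes one side of the pairing more
  massive than the other. If the boundary is thick, a ball of radius \<open>\<rho>\<close> around one of its points
  contains at least a constant times \<open>\<epsilon> powr - l\<close> boundary points at mutual distance \<open>\<epsilon> * \<rho>\<close>, with
  \<open>l > n - \<eta>\<close>, and plumpness puts next to each of them a ball of radius comparable to
  \<open>\<epsilon> * \<rho>\<close> into the domain (\<open>thick_frontier_lower_volume\<close>). So \<open>x\<close> has many partners, and the
  factor is of order \<open>\<epsilon> powr (\<eta> + l - n)\<close>. If the boundary is thin, it is plumpness that gives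
  \<open>x\<close> partners, whereas few \<open>x\<close> share a partner \<open>y\<close>: they lie in a layer along the boundary, which is
  covered by at most a constant times \<open>\<epsilon> powr - l\<close> balls, now with \<open>l < n - \<eta>\<close>
  (\<open>thin_frontier_upper_volume\<close>), and the factor is of order \<open>\<epsilon> powr (n - \<eta> - l)\<close>. In both cases
  the scaling condition on \<open>\<phi>\<close> compares the weights at \<open>x\<close> and \<open>y\<close> in the direction of the pairing,
  at the cost of the power of \<open>\<epsilon>\<close> with exponent \<open>\<eta>\<close> or \<open>- \<eta>\<close>.
\<close>

section \<open>Distance to the boundary\<close>

lemma bdry_dist_pos:
  assumes "open D" "D \<noteq> UNIV" "x \<in> D"
  shows "0 < bdry_dist D x"
  unfolding bdry_dist_def using assms by (intro infdist_pos_not_in_closed) auto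

lemma bdry_dist_le_frontier:
  assumes "open D" "z \<in> frontier D"
  shows "bdry_dist D x \<le> dist x z"
  unfolding bdry_dist_def using assms
  by (intro infdist_le) (auto simp: frontier_def interior_open)

lemma bdry_dist_ge:
  assumes "D \<noteq> UNIV" "ball x s \<subseteq> D"
  shows "s \<le> bdry_dist D x"
proof -
  have "- D \<noteq> {}" using assms(1) by auto
  then show ?thesis
    unfolding bdry_dist_def using assms(2)
    by (auto simp: infdist_notempty intro!: cINF_greatest) (meson linorder_not_le mem_ball subsetD)
qed

lemma bdry_dist_lipschitz: "bdry_dist D x \<le> bdry_dist D y + dist x y"
  unfolding bdry_dist_def by (rule infdist_triangle)

lemma borel_measurable_bdry_dist [measurable]: "bdry_dist D \<in> borel_measurable borel"
proof -
  have "continuous_on UNIV (bdry_dist D)"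
    unfolding bdry_dist_def by (intro continuous_intros)
  then show ?thesis by (rule borel_measurable_continuous_onI)
qed

text \<open>The segment from \<open>x\<close> to a nearest point of the complement meets the frontier. As the frontier of
  an open set lies in the complement, the meeting point is no nearer to \<open>x\<close> than the end of the
  segment.\<close>
lemma nearest_frontier_point:
  fixes D :: "'a::euclidean_space set"
  assumes "open D" "D \<noteq> UNIV" "x \<in> D"
  obtains z where "z \<in> frontier D" "dist x z = bdry_dist D x"
proof -
  obtain y where y: "y \<in> - D" "infdist x (- D) = dist x y"
    using infdist_attains_inf[of "- D" x] assms by auto
  have "closed_segment x y \<inter> frontier D \<noteq> {}"
    by (rule connected_Int_frontier) (use assms y in auto)
  then obtain z where z: "z \<in> closed_segment x y" "z \<in> frontier D" by auto
  have "dist x z \<le> dist x y" using z(1) segment_bound(1)[of z x y]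
    by (simp add: dist_norm norm_minus_commute)
  moreover have "bdry_dist D x \<le> dist x z" using z assms by (intro bdry_dist_le_frontier)
  ultimately have "dist x z = bdry_dist D x" using y(2) by (simp add: bdry_dist_def)
  with z that show ?thesis by blast
qed

section \<open>Diameters, separated sets and coverings\<close>

lemma dist_le_ediam: "x \<in> S \<Longrightarrow> y \<in> S \<Longrightarrow> ennreal (dist x y) \<le> ediam S"
  unfolding ediam_def by (meson SUP_upper2 order_refl)

lemma ediam_unbounded:
  assumes "\<not> bounded S"
  shows "ediam S = top"
proof (rule ccontr)
  assume "ediam S \<noteq> top"
  then obtain e where "0 \<le> e" "ediam S = ennreal e" by (cases "ediam S") auto
  then have "\<forall>x\<in>S. \<forall>y\<in>S. dist x y \<le> e" by (metis dist_le_ediam ennreal_le_iff)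
  then show False using assms bounded_two_points by blast
qed

text \<open>A separated set of greatest cardinality is a cover, so covering numbers bound packing numbers
  from below.\<close>
lemma separated_subset_of_cover_bound:
  fixes S :: "'a::metric_space set" and L :: real
  assumes "0 < r" "S \<subseteq> E"
    and cover: "\<And>F. finite F \<Longrightarrow> ball_cover E r S F \<Longrightarrow> L \<le> real (card F)"
  obtains F where "finite F" "F \<subseteq> S" "L \<le> real (card F)"
    "\<And>x y. x \<in> F \<Longrightarrow> y \<in> F \<Longrightarrow> x \<noteq> y \<Longrightarrow> r \<le> dist x y"
proof -
  define Q where "Q F \<longleftrightarrow> finite F \<and> F \<subseteq> S \<and> (\<forall>x\<in>F. \<forall>y\<in>F. x \<noteq> y \<longrightarrow> r \<le> dist x y)" for F
  have "\<exists>F. Q F \<and> L \<le> real (card F)"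
  proof (rule ccontr)
    assume neg: "\<not> ?thesis"
    have "Q {}" by (simp add: Q_def)
    moreover have "\<forall>F. Q F \<longrightarrow> card F < Suc (nat \<lceil>L\<rceil>)"
      using neg by (smt (verit) le_nat_iff less_Suc_eq_le linorder_not_less nat_ceiling_le_eq order_less_imp_le)
    ultimately obtain F where F: "Q F" and mx: "\<And>G. Q G \<Longrightarrow> card G \<le> card F"
      using Lattices_Big.ex_has_greatest_nat[of Q "{}" card] by metis
    have "S \<subseteq> (\<Union>y\<in>F. ball y r)"
    proof
      fix x assume x: "x \<in> S"
      show "x \<in> (\<Union>y\<in>F. ball y r)"
      proof (rule ccontr)
        assume "x \<notin> (\<Union>y\<in>F. ball y r)"
        then have far: "r \<le> dist y x" if "y \<in> F" for y using that by (auto simp: not_less)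
        then have "x \<notin> F" using \<open>0 < r\<close> by force
        have "Q (insert x F)" using F x far by (auto simp: Q_def dist_commute)
        from mx[OF this] show False using F \<open>x \<notin> F\<close> by (simp add: Q_def)
      qed
    qed
    then have "ball_cover E r S F" using F \<open>S \<subseteq> E\<close> by (auto simp: Q_def ball_cover_def)
    moreover have "finite F" using F by (simp add: Q_def)
    ultimately have "L \<le> real (card F)" by (intro cover)
    with F have "Q F \<and> L \<le> real (card F)" ..
    with neg show False by metis
  qed
  then obtain F where "Q F" "L \<le> real (card F)" by blast
  then show ?thesis by (intro that[of F]) (auto simp: Q_def)
qed

text \<open>Radii beyond twice the diameter add nothing: there a ball contains the whole set, which is
  covered either by one ball or as efficiently as a ball of radius three halves of the diameter.
  This matters for unbounded domains whose boundary is bounded.\<close>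
lemma cover_bound_all_radii:
  fixes E :: "'a::metric_space set"
  assumes "0 \<le> l" "0 < C"
    and cover: "\<forall>r R. \<forall>x\<in>E. 0 < r \<and> r < R \<and> ennreal R < 2 * ediam E \<longrightarrow>
        (\<exists>F. finite F \<and> ball_cover E r (ball x R \<inter> E) F \<and> real (card F) \<le> C * (R / r) powr l)"
    and x: "x \<in> E" and r: "0 < r" "r < R"
  obtains F where "finite F" "ball_cover E r (ball x R \<inter> E) F"
    "real (card F) \<le> max 1 C * (R / r) powr l"
proof (cases "ennreal R < 2 * ediam E")
  case True
  then obtain F where F: "finite F" "ball_cover E r (ball x R \<inter> E) F"
    "real (card F) \<le> C * (R / r) powr l" using cover x r by blast
  have "C * (R / r) powr l \<le> max 1 C * (R / r) powr l" by (intro mult_right_mono) auto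
  with F that show ?thesis by force
next
  case False
  then have le: "2 * ediam E \<le> ennreal R" by simp
  have "ediam E \<noteq> top"
  proof
    assume "ediam E = top"
    then show False using le by (simp add: ennreal_mult_top top_unique)
  qed
  then obtain e where e: "0 \<le> e" "ediam E = ennreal e" by (cases "ediam E") auto
  have eR: "2 * e \<le> R"
  proof -
    have "ennreal (2 * e) = 2 * ediam E"
      by (simp add: e ennreal_mult flip: ennreal_numeral)
    then have "ennreal (2 * e) \<le> ennreal R" using le by simp
    then show ?thesis using r by (subst (asm) ennreal_le_iff) auto
  qed
  have dist_e: "dist x y \<le> e" if "y \<in> E" for y
    using dist_le_ediam[OF x that] e by simp
  show ?thesis
  proof (cases "e < r")
    case True
    have "ball_cover E r (ball x R \<inter> E) {x}"
      using x dist_e True by (force simp: ball_cover_def)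
    moreover have "1 * 1 \<le> max 1 C * (R / r) powr l"
      using r assms by (intro mult_mono ge_one_powr_ge_zero) auto
    ultimately show ?thesis using that[of "{x}"] by simp
  next
    case False
    have "ennreal (3 / 2 * e) < 2 * ediam E"
    proof -
      have "2 * ediam E = ennreal (2 * e)"
        by (simp add: e ennreal_mult flip: ennreal_numeral)
      moreover have "ennreal (3 / 2 * e) < ennreal (2 * e)"
        using False r by (intro ennreal_lessI) auto
      ultimately show ?thesis by simp
    qed
    moreover have "r < 3 / 2 * e" using False r by auto
    ultimately obtain F where F: "finite F" "ball_cover E r (ball x (3 / 2 * e) \<inter> E) F"
      "real (card F) \<le> C * (3 / 2 * e / r) powr l" using cover x r by blast
    have "E \<subseteq> ball x (3 / 2 * e)" using dist_e False r by force
    then have "ball_cover E r (ball x R \<inter> E) F" using F by (auto simp: ball_cover_def)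
    moreover have "C * (3 / 2 * e / r) powr l \<le> max 1 C * (R / r) powr l"
      using r e eR assms by (intro mult_mono powr_mono2 divide_right_mono) auto
    ultimately show ?thesis using that F by force
  qed
qed

section \<open>Absorbing an average\<close>

text \<open>Bound \<open>\<bar>u x\<bar>\<close> by \<open>\<bar>u y\<bar>\<close> and the difference, and average over the partners \<open>y\<close> of \<open>x\<close>.
  After exchanging the integrals the part with \<open>\<bar>u y\<bar>\<close> is at most half of the left-hand side, which
  is finite and can be subtracted.\<close>
lemma nn_integral_le_differences_by_absorption:
  fixes D :: "'a::euclidean_space set" and u w m :: "'a \<Rightarrow> real"
  assumes [measurable]: "P \<in> sets (lborel \<Otimes>\<^sub>M lborel)" "D \<in> sets lborel"
      "u \<in> borel_measurable lborel" "w \<in> borel_measurable lborel" "m \<in> borel_measurable lborel"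
    and P: "P \<subseteq> D \<times> D"
    and "0 < p" "0 < a" "0 \<le> b" "2 powr p * b \<le> a / 2"
    and w: "\<And>x. x \<in> D \<Longrightarrow> 0 \<le> w x" and m: "\<And>x. x \<in> D \<Longrightarrow> 0 < m x"
    and lower: "\<And>x. x \<in> D \<Longrightarrow> ennreal (a * m x) \<le> emeasure lborel {y. (x, y) \<in> P}"
    and upper: "\<And>y. y \<in> D \<Longrightarrow>
      (\<integral>\<^sup>+x. ennreal (w x / m x) * indicator P (x, y) \<partial>lborel) \<le> ennreal (b * w y)"
    and finite: "(\<integral>\<^sup>+x\<in>D. ennreal (\<bar>u x\<bar> powr p * w x) \<partial>lborel) < \<infinity>"
  shows "(\<integral>\<^sup>+x\<in>D. ennreal (\<bar>u x\<bar> powr p * w x) \<partial>lborel) \<le> ennreal (2 * 2 powr p / a) *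
    (\<integral>\<^sup>+x. \<integral>\<^sup>+y. ennreal (\<bar>u x - u y\<bar> powr p * (w x / m x)) * indicator P (x, y) \<partial>lborel \<partial>lborel)"
proof -
  define I where "I = (\<integral>\<^sup>+x\<in>D. ennreal (\<bar>u x\<bar> powr p * w x) \<partial>lborel)"
  define J where "J = (\<integral>\<^sup>+x. \<integral>\<^sup>+y. ennreal (\<bar>u x - u y\<bar> powr p * (w x / m x)) * indicator P (x, y) \<partial>lborel \<partial>lborel)"
  define B where "B = (\<integral>\<^sup>+x. \<integral>\<^sup>+y. ennreal (\<bar>u y\<bar> powr p * (w x / m x)) * indicator P (x, y) \<partial>lborel \<partial>lborel)"
  have triangle: "\<bar>s\<bar> powr p \<le> 2 powr p * (\<bar>t\<bar> powr p + \<bar>s - t\<bar> powr p)" for s t :: real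
  proof -
    have "\<bar>s\<bar> \<le> 2 * max \<bar>t\<bar> \<bar>s - t\<bar>" by (simp add: max_def abs_if)
    then have "\<bar>s\<bar> powr p \<le> (2 * max \<bar>t\<bar> \<bar>s - t\<bar>) powr p"
      using \<open>0 < p\<close> by (intro powr_mono2) auto
    also have "\<dots> = 2 powr p * max \<bar>t\<bar> \<bar>s - t\<bar> powr p" by (simp add: powr_mult)
    also have "\<dots> \<le> 2 powr p * (\<bar>t\<bar> powr p + \<bar>s - t\<bar> powr p)"
      by (intro mult_left_mono) (auto simp: max_def)
    finally show ?thesis .
  qed
  have distr: "ennreal (c * (s + t)) = ennreal c * (ennreal s + ennreal t)"
    if "0 \<le> c" "0 \<le> s" "0 \<le> t" for c s t
    using that by (simp add: ennreal_mult)
  have "ennreal a * I = (\<integral>\<^sup>+x. ennreal a * (ennreal (\<bar>u x\<bar> powr p * w x) * indicator D x) \<partial>lborel)"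
    unfolding I_def by (subst nn_integral_cmult) auto
  also have "\<dots> \<le> (\<integral>\<^sup>+x. \<integral>\<^sup>+y. ennreal (2 powr p) * (ennreal (\<bar>u y\<bar> powr p * (w x / m x)) * indicator P (x, y) +
        ennreal (\<bar>u x - u y\<bar> powr p * (w x / m x)) * indicator P (x, y)) \<partial>lborel \<partial>lborel)"
  proof (rule nn_integral_mono)
    fix x :: 'a
    show "ennreal a * (ennreal (\<bar>u x\<bar> powr p * w x) * indicator D x) \<le>
      (\<integral>\<^sup>+y. ennreal (2 powr p) * (ennreal (\<bar>u y\<bar> powr p * (w x / m x)) * indicator P (x, y) +
        ennreal (\<bar>u x - u y\<bar> powr p * (w x / m x)) * indicator P (x, y)) \<partial>lborel)"
    proof (cases "x \<in> D")
      case True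
      have pos: "0 \<le> w x / m x" using w[OF True] m[OF True] by simp
      have "Pair x -` P \<in> sets lborel" by measurable
      then have S [measurable]: "{y. (x, y) \<in> P} \<in> sets lborel" by (simp add: vimage_def)
      have "ennreal a * (ennreal (\<bar>u x\<bar> powr p * w x) * indicator D x)
          = ennreal (\<bar>u x\<bar> powr p * (w x / m x)) * ennreal (a * m x)"
        using True w[OF True] m[OF True] \<open>0 < a\<close> by (simp flip: ennreal_mult)
      also have "\<dots> \<le> ennreal (\<bar>u x\<bar> powr p * (w x / m x)) * emeasure lborel {y. (x, y) \<in> P}"
        by (intro mult_left_mono lower True) auto
      also have "\<dots> = (\<integral>\<^sup>+y. ennreal (\<bar>u x\<bar> powr p * (w x / m x)) * indicator {y. (x, y) \<in> P} y \<partial>lborel)"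
        by (subst nn_integral_cmult_indicator) auto
      also have "\<dots> \<le> (\<integral>\<^sup>+y. ennreal (2 powr p) * (ennreal (\<bar>u y\<bar> powr p * (w x / m x)) * indicator P (x, y) +
        ennreal (\<bar>u x - u y\<bar> powr p * (w x / m x)) * indicator P (x, y)) \<partial>lborel)"
      proof (rule nn_integral_mono)
        fix y
        have "\<bar>u x\<bar> powr p * (w x / m x) \<le>
            2 powr p * (\<bar>u y\<bar> powr p + \<bar>u x - u y\<bar> powr p) * (w x / m x)"
          by (rule mult_right_mono[OF triangle pos])
        then have "ennreal (\<bar>u x\<bar> powr p * (w x / m x)) \<le>
            ennreal (2 powr p * (\<bar>u y\<bar> powr p * (w x / m x) + \<bar>u x - u y\<bar> powr p * (w x / m x)))"
          by (intro ennreal_leI) (simp add: algebra_simps)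
        also have "\<dots> = ennreal (2 powr p) * (ennreal (\<bar>u y\<bar> powr p * (w x / m x)) +
            ennreal (\<bar>u x - u y\<bar> powr p * (w x / m x)))"
          by (intro distr mult_nonneg_nonneg pos powr_ge_zero)
        finally show "ennreal (\<bar>u x\<bar> powr p * (w x / m x)) * indicator {y. (x, y) \<in> P} y \<le>
          ennreal (2 powr p) * (ennreal (\<bar>u y\<bar> powr p * (w x / m x)) * indicator P (x, y) +
          ennreal (\<bar>u x - u y\<bar> powr p * (w x / m x)) * indicator P (x, y))"
          by (auto simp: indicator_def)
      qed
      finally show ?thesis .
    qed simp
  qed
  also have "\<dots> = ennreal (2 powr p) * (B + J)"
    unfolding B_def J_def
    by (simp add: nn_integral_cmult nn_integral_add)
  finally have aI: "ennreal a * I \<le> ennreal (2 powr p) * (B + J)" .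
  have "B = (\<integral>\<^sup>+y. \<integral>\<^sup>+x. ennreal (\<bar>u y\<bar> powr p * (w x / m x)) * indicator P (x, y) \<partial>lborel \<partial>lborel)"
    unfolding B_def by (rule lborel_pair.Fubini'[symmetric]) measurable
  also have "\<dots> \<le> (\<integral>\<^sup>+y. ennreal b * (ennreal (\<bar>u y\<bar> powr p * w y) * indicator D y) \<partial>lborel)"
  proof (rule nn_integral_mono)
    fix y :: 'a
    have "(\<integral>\<^sup>+x. ennreal (\<bar>u y\<bar> powr p * (w x / m x)) * indicator P (x, y) \<partial>lborel) =
        (\<integral>\<^sup>+x. ennreal (\<bar>u y\<bar> powr p) * (ennreal (w x / m x) * indicator P (x, y)) \<partial>lborel)"
      by (intro nn_integral_cong, subst ennreal_mult') (simp_all add: mult.assoc)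
    also have "\<dots> = ennreal (\<bar>u y\<bar> powr p) * (\<integral>\<^sup>+x. ennreal (w x / m x) * indicator P (x, y) \<partial>lborel)"
      by (rule nn_integral_cmult) measurable
    also have "\<dots> \<le> ennreal b * (ennreal (\<bar>u y\<bar> powr p * w y) * indicator D y)"
    proof (cases "y \<in> D")
      case True
      have "ennreal (\<bar>u y\<bar> powr p) * (\<integral>\<^sup>+x. ennreal (w x / m x) * indicator P (x, y) \<partial>lborel) \<le>
          ennreal (\<bar>u y\<bar> powr p) * ennreal (b * w y)"
        by (intro mult_left_mono upper True) auto
      also have "\<dots> = ennreal b * (ennreal (\<bar>u y\<bar> powr p * w y) * indicator D y)"
        using True w[OF True] \<open>0 \<le> b\<close> by (simp add: mult_ac flip: ennreal_mult)
      finally show ?thesis .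
    next
      case False
      then have "indicator P (x, y) = (0::ennreal)" for x using P by (auto simp: indicator_def)
      then show ?thesis by simp
    qed
    finally show "(\<integral>\<^sup>+x. ennreal (\<bar>u y\<bar> powr p * (w x / m x)) * indicator P (x, y) \<partial>lborel) \<le>
      ennreal b * (ennreal (\<bar>u y\<bar> powr p * w y) * indicator D y)" .
  qed
  also have "\<dots> = ennreal b * I"
    unfolding I_def by (rule nn_integral_cmult) measurable
  finally have BI: "B \<le> ennreal b * I" .
  have main: "I \<le> ennreal (2 * 2 powr p / a) * J"
  proof (cases "J = top")
    case True
    then show ?thesis using \<open>0 < a\<close> by (simp add: ennreal_mult_top)
  next
    case False
    then obtain j where j: "0 \<le> j" "J = ennreal j" by (cases J) auto
    obtain i where i: "0 \<le> i" "I = ennreal i" using finite unfolding I_def[symmetric] by (cases I) auto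
    have "ennreal a * I \<le> ennreal (2 powr p) * (ennreal b * I + J)"
      using aI BI by (meson add_right_mono mult_left_mono order_trans zero_le)
    then have "a * i \<le> 2 powr p * (b * i + j)"
      using i j \<open>0 < a\<close> \<open>0 \<le> b\<close> by (simp flip: ennreal_mult ennreal_plus)
    also have "\<dots> \<le> a / 2 * i + 2 powr p * j"
      using mult_right_mono[OF \<open>2 powr p * b \<le> a / 2\<close> \<open>0 \<le> i\<close>] by (simp add: algebra_simps)
    finally have "i \<le> 2 * 2 powr p / a * j" using \<open>0 < a\<close> by (simp add: field_simps)
    then show ?thesis using i j \<open>0 < a\<close> by (simp flip: ennreal_mult)
  qed
  then show ?thesis unfolding I_def J_def .
qed

section \<open>Replacing the gauge by a Borel function\<close>

text \<open>The supremum of an almost increasing function over \<open>{0<..s}\<close> is monotone, hence Borel.\<close>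
lemma almost_mono_imp_comparable_borel:
  fixes g :: "real \<Rightarrow> real"
  assumes "0 < H" and pos: "\<And>s. 0 < s \<Longrightarrow> 0 < g s"
    and almost: "\<And>s t. 0 < s \<Longrightarrow> s \<le> t \<Longrightarrow> H * g s \<le> g t"
  obtains k where "k \<in> borel_measurable borel" "\<And>s. 0 < s \<Longrightarrow> g s \<le> k s" "\<And>s. 0 < s \<Longrightarrow> k s \<le> g s / H"
proof
  define k where "k s = (if s \<le> 0 then 0 else SUP t\<in>{0<..s}. g t)" for s
  have le: "g t \<le> g s / H" if "0 < t" "t \<le> s" for s t
    using almost[OF that] \<open>0 < H\<close> by (simp add: field_simps)
  have bdd: "bdd_above (g ` {0<..s})" for s
    by (rule bdd_aboveI[of _ "g s / H"]) (auto intro: le)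
  show lower: "g s \<le> k s" if "0 < s" for s
    using that bdd by (auto simp: k_def intro!: cSUP_upper)
  show "k s \<le> g s / H" if "0 < s" for s
    using that le by (auto simp: k_def intro!: cSUP_least)
  have "mono k"
  proof (rule monoI)
    fix s t :: real assume "s \<le> t"
    show "k s \<le> k t"
    proof (cases "0 < s")
      case True
      then show ?thesis using \<open>s \<le> t\<close> bdd unfolding k_def by (auto intro!: cSUP_subset_mono)
    next
      case False
      then have "k s = 0" by (simp add: k_def)
      moreover have "0 \<le> k t"
      proof (cases "0 < t")
        case True
        then show ?thesis using lower[of t] pos[of t] by linarith
      qed (simp add: k_def)
      ultimately show ?thesis by simp
    qed
  qed
  then show "k \<in> borel_measurable borel" by (rule borel_measurable_mono)
qed

text \<open>Both scaling classes give the same inequality: WLSC when \<open>t\<close> is the smaller argument, WUSC when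
  it is the larger one.\<close>
lemma WLSC_scaling:
  assumes "WLSC \<eta> H \<phi>" "0 < H" "0 < t" "t \<le> s"
  shows "\<phi> t \<le> (t / s) powr \<eta> / H * \<phi> s"
proof -
  have "H * (s / t) powr \<eta> * \<phi> t \<le> \<phi> (t * (s / t))"
    using assms unfolding WLSC_def by (metis divide_self_if le_divide_eq_1_pos less_irrefl)
  then have "H * (s / t) powr \<eta> * \<phi> t \<le> \<phi> s" using assms by simp
  then have "(t / s) powr \<eta> / H * (H * (s / t) powr \<eta> * \<phi> t) \<le> (t / s) powr \<eta> / H * \<phi> s"
    using assms by (intro mult_left_mono) auto
  then show ?thesis using assms by (simp add: powr_divide)
qed

lemma WUSC_scaling:
  assumes "WUSC \<eta> (inverse H) \<phi>" "0 < H" "0 < s" "s \<le> t"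
  shows "\<phi> t \<le> (t / s) powr \<eta> / H * \<phi> s"
proof -
  have "s / t \<in> {0<..1}" using assms by auto
  then have "inverse (inverse H) * (s / t) powr \<eta> * \<phi> t \<le> \<phi> (t * (s / t))"
    using assms unfolding WUSC_def by (metis less_le_trans)
  then have "H * (s / t) powr \<eta> * \<phi> t \<le> \<phi> s" using assms by simp
  then have "(t / s) powr \<eta> / H * (H * (s / t) powr \<eta> * \<phi> t) \<le> (t / s) powr \<eta> / H * \<phi> s"
    using assms by (intro mult_left_mono) auto
  then show ?thesis using assms by (simp add: powr_divide)
qed

text \<open>Either scaling condition makes \<open>\<phi> s / s powr \<eta>\<close> almost monotone, increasing for WLSC and
  decreasing for WUSC; in the second case its reciprocal is almost increasing. A Borel gauge in place
  of \<open>\<phi>\<close> turns the weight into a Borel function of the point, as Tonelli's theorem requires.\<close>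
lemma scaling_imp_comparable_borel:
  fixes \<phi> :: "real \<Rightarrow> real"
  assumes "0 < H" and pos: "\<And>s. 0 < s \<Longrightarrow> 0 < \<phi> s"
    and scaling: "WUSC \<eta> (inverse H) \<phi> \<or> WLSC \<eta> H \<phi>"
  obtains \<psi> where "\<psi> \<in> borel_measurable borel"
    "\<And>s. 0 < s \<Longrightarrow> \<phi> s \<le> \<psi> s" "\<And>s. 0 < s \<Longrightarrow> \<psi> s \<le> \<phi> s / H"
proof -
  define g where "g s = \<phi> s / s powr \<eta>" for s
  have g_pos: "0 < g s" if "0 < s" for s using pos that by (simp add: g_def)
  have "\<exists>k\<in>borel_measurable borel. \<forall>s>0. g s \<le> k s \<and> k s \<le> g s / H"
    using scaling
  proof
    assume "WLSC \<eta> H \<phi>"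
    from WLSC_scaling[OF this] have "H * g s \<le> g t" if "0 < s" "s \<le> t" for s t
      using that \<open>0 < H\<close> by (auto simp: g_def powr_divide field_simps)
    then obtain k where "k \<in> borel_measurable borel"
      "\<And>s. 0 < s \<Longrightarrow> g s \<le> k s" "\<And>s. 0 < s \<Longrightarrow> k s \<le> g s / H"
      using almost_mono_imp_comparable_borel[OF \<open>0 < H\<close>, of g] g_pos by auto
    then show ?thesis by blast
  next
    assume "WUSC \<eta> (inverse H) \<phi>"
    from WUSC_scaling[OF this] have "H * g t \<le> g s" if "0 < s" "s \<le> t" for s t
      using that \<open>0 < H\<close> by (auto simp: g_def powr_divide field_simps)
    then have "H * (1 / g s) \<le> 1 / g t" if "0 < s" "s \<le> t" for s t
      using that g_pos[of s] g_pos[of t] by (simp add: field_simps)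
    then obtain k where k: "k \<in> borel_measurable borel"
      "\<And>s. 0 < s \<Longrightarrow> 1 / g s \<le> k s" "\<And>s. 0 < s \<Longrightarrow> k s \<le> 1 / g s / H"
      using almost_mono_imp_comparable_borel[OF \<open>0 < H\<close>, of "\<lambda>s. 1 / g s"] g_pos by auto
    have "g s \<le> 1 / (H * k s) \<and> 1 / (H * k s) \<le> g s / H" if "0 < s" for s
    proof -
      have "0 < 1 / g s" using g_pos that by simp
      then have "0 < k s" using k(2)[OF that] by linarith
      then show ?thesis using k(2,3)[OF that] g_pos[OF that] \<open>0 < H\<close>
        by (simp add: field_simps)
    qed
    moreover have "(\<lambda>s. 1 / (H * k s)) \<in> borel_measurable borel" using k(1) by measurable
    ultimately show ?thesis by (intro bexI[of _ "\<lambda>s. 1 / (H * k s)"]) auto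
  qed
  then obtain k where [measurable]: "k \<in> borel_measurable borel"
    and k: "\<And>s. 0 < s \<Longrightarrow> g s \<le> k s" "\<And>s. 0 < s \<Longrightarrow> k s \<le> g s / H" by blast
  show ?thesis
  proof
    show "(\<lambda>s. k s * s powr \<eta>) \<in> borel_measurable borel" by measurable
    show "\<phi> s \<le> k s * s powr \<eta>" "k s * s powr \<eta> \<le> \<phi> s / H" if "0 < s" for s
      using k[OF that] that \<open>0 < H\<close> by (auto simp: g_def field_simps)
  qed
qed

section \<open>Pairs of points at comparable heights\<close>

text \<open>The second point has between \<open>\<alpha>\<close> and \<open>\<beta>\<close> times the height of the first, where height means
  distance to the boundary. The thick case takes \<open>\<alpha>\<close> and \<open>\<beta>\<close> of order \<open>\<epsilon>\<close>, the thin case of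
  order \<open>1 / \<epsilon>\<close>.\<close>
definition comparable_pairs :: "'a::metric_space set \<Rightarrow> real \<Rightarrow> real \<Rightarrow> real \<Rightarrow> ('a \<times> 'a) set" where
  "comparable_pairs D R \<alpha> \<beta> = {(x, y). x \<in> D \<and> y \<in> D \<and> dist x y < R * bdry_dist D x \<and>
    \<alpha> * bdry_dist D x \<le> bdry_dist D y \<and> bdry_dist D y \<le> \<beta> * bdry_dist D x}"

lemma sets_comparable_pairs [measurable]:
  fixes D :: "'a::euclidean_space set"
  assumes "open D"
  shows "comparable_pairs D R \<alpha> \<beta> \<in> sets (lborel \<Otimes>\<^sub>M lborel)"
proof -
  have [measurable]: "D \<in> sets borel" using assms by auto
  have "{z \<in> space (borel \<Otimes>\<^sub>M borel). fst z \<in> D \<and> snd z \<in> D \<and> dist (fst z) (snd z) < R * bdry_dist D (fst z) \<and>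
    \<alpha> * bdry_dist D (fst z) \<le> bdry_dist D (snd z) \<and> bdry_dist D (snd z) \<le> \<beta> * bdry_dist D (fst z)}
    \<in> sets (borel \<Otimes>\<^sub>M borel)" by measurable
  also have "{z \<in> space (borel \<Otimes>\<^sub>M borel). fst z \<in> D \<and> snd z \<in> D \<and> dist (fst z) (snd z) < R * bdry_dist D (fst z) \<and>
    \<alpha> * bdry_dist D (fst z) \<le> bdry_dist D (snd z) \<and> bdry_dist D (snd z) \<le> \<beta> * bdry_dist D (fst z)} =
    comparable_pairs D R \<alpha> \<beta>"
    by (auto simp: comparable_pairs_def space_pair_measure)
  finally show ?thesis by (simp cong: sets_pair_measure_cong)
qed

lemma sets_comparable_pairs_sections:
  fixes D :: "'a::euclidean_space set"
  assumes "open D"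
  shows "{y. (x, y) \<in> comparable_pairs D R \<alpha> \<beta>} \<in> sets lborel"
    "{x. (x, y) \<in> comparable_pairs D R \<alpha> \<beta>} \<in> sets lborel"
proof -
  note [measurable] = sets_comparable_pairs[OF assms, of R \<alpha> \<beta>]
  have "Pair x -` comparable_pairs D R \<alpha> \<beta> \<in> sets lborel" by measurable
  then show "{y. (x, y) \<in> comparable_pairs D R \<alpha> \<beta>} \<in> sets lborel" by (simp add: vimage_def)
  have "(\<lambda>x. (x, y)) -` comparable_pairs D R \<alpha> \<beta> \<in> sets lborel"
    by (rule sets_Pair2) measurable
  then show "{x. (x, y) \<in> comparable_pairs D R \<alpha> \<beta>} \<in> sets lborel" by (simp add: vimage_def)
qed

subsection \<open>Thick boundary\<close>

text \<open>A line through \<open>x\<close> leaves a bounded open set on both sides, at distance at least that of \<open>x\<close> to the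
  boundary. So this distance is an admissible radius in the
  definition of the Assouad dimensions of the boundary.\<close>
lemma two_bdry_dist_le_ediam_frontier:
  fixes D :: "'a::euclidean_space set"
  assumes "open D" "bounded D" "x \<in> D"
  shows "ennreal (2 * bdry_dist D x) \<le> ediam (frontier D)"
proof -
  obtain e :: 'a where e: "e \<in> Basis" using nonempty_Basis by blast
  then have e1: "norm e = 1" "e \<noteq> 0" "- e \<noteq> 0" by auto
  have x: "x \<in> interior D" using assms interior_open by auto
  obtain s where s: "0 < s" "x + s *\<^sub>R e \<in> frontier D" using ray_to_frontier[OF assms(2) x e1(2)] by blast
  obtain t where t: "0 < t" "x + t *\<^sub>R (- e) \<in> frontier D" using ray_to_frontier[OF assms(2) x e1(3)] by blast
  have "bdry_dist D x \<le> s" "bdry_dist D x \<le> t"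
    using bdry_dist_le_frontier[OF assms(1) s(2), of x] bdry_dist_le_frontier[OF assms(1) t(2), of x] s t e1
    by (auto simp: dist_norm)
  moreover have "dist (x + s *\<^sub>R e) (x + t *\<^sub>R (- e)) = s + t"
  proof -
    have "x + s *\<^sub>R e - (x + t *\<^sub>R (- e)) = (s + t) *\<^sub>R e" by (simp add: algebra_simps)
    then show ?thesis using s t e1 by (simp only: dist_norm norm_scaleR) simp
  qed
  ultimately have "ennreal (2 * bdry_dist D x) \<le> ennreal (dist (x + s *\<^sub>R e) (x + t *\<^sub>R (- e)))"
    by (intro ennreal_leI) auto
  also have "\<dots> \<le> ediam (frontier D)" by (rule dist_le_ediam[OF s(2) t(2)])
  finally show ?thesis .
qed

lemma bdry_dist_le_ediam:
  fixes D :: "'a::euclidean_space set"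
  assumes "open D" "x \<in> D" "0 < t" "t < bdry_dist D x"
  shows "ennreal t \<le> ediam D"
proof -
  obtain e :: 'a where e: "e \<in> Basis" using nonempty_Basis by blast
  have d: "dist x (x + t *\<^sub>R e) = t" using e assms by (simp add: dist_norm)
  have "x + t *\<^sub>R e \<in> D"
  proof (rule ccontr)
    assume "x + t *\<^sub>R e \<notin> D"
    then have "bdry_dist D x \<le> dist x (x + t *\<^sub>R e)" unfolding bdry_dist_def by (intro infdist_le) auto
    then show False using d assms by simp
  qed
  from dist_le_ediam[OF \<open>x \<in> D\<close> this] d show ?thesis by simp
qed

lemma bdry_dist_ge_half_radius:
  assumes "D \<noteq> UNIV" "ball z (2 * s) \<subseteq> D" "y \<in> ball z s"
  shows "s \<le> bdry_dist D y"
proof (rule bdry_dist_ge[OF assms(1)])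
  have "ball y s \<subseteq> ball z (2 * s)"
    using assms(3) by (intro subsetI) (metis (no_types, opaque_lifting) dist_commute dist_triangle_half_l dist_triangle_lt field_sum_of_halves mem_ball add_strict_mono mult_2)
  then show "ball y s \<subseteq> D" using assms(2) by blast
qed

text \<open>Near \<open>x\<close> the boundary contains many points at mutual distance \<open>\<epsilon> * \<rho>\<close>. Plumpness at scale
  \<open>\<epsilon> * \<rho> / 4\<close> puts a ball of radius \<open>\<kappa> * \<epsilon> * \<rho> / 4\<close> in the domain next to each. The concentric balls
  of half that radius are disjoint and consist of partners of \<open>x\<close>.\<close>
lemma thick_frontier_lower_volume:
  fixes D :: "'a::euclidean_space set"
  assumes D: "open D" "D \<noteq> UNIV" "plump \<kappa> D" "0 < \<kappa>" "\<kappa> < 1"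
    and bdd: "bounded D \<or> \<not> bounded (frontier D)"
    and \<epsilon>: "0 < \<epsilon>" "\<epsilon> < 1" and "0 < C"
    and count: "\<forall>r R. \<forall>x\<in>frontier D. 0 < r \<and> r < R \<and> ennreal R < 2 * ediam (frontier D) \<longrightarrow>
        (\<forall>F. finite F \<and> ball_cover (frontier D) r (ball x R \<inter> frontier D) F \<longrightarrow>
          C * (R / r) powr l \<le> real (card F))"
    and x: "x \<in> D"
  shows "ennreal (C * (1 / \<epsilon>) powr l * (unit_ball_vol DIM('a) * (\<kappa> * \<epsilon> / 8) ^ DIM('a)) * bdry_dist D x ^ DIM('a))
    \<le> emeasure lborel {y. (x, y) \<in> comparable_pairs D 3 (\<kappa> * \<epsilon> / 8) (\<epsilon> / 2)}"
proof -
  define \<rho> where "\<rho> = bdry_dist D x"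
  have \<rho>: "0 < \<rho>" using D x unfolding \<rho>_def by (intro bdry_dist_pos)
  define s where "s = \<kappa> * \<epsilon> / 8 * \<rho>"
  have s: "0 < s" using \<rho> \<epsilon> D by (simp add: s_def)
  have "\<kappa> * (\<epsilon> * \<rho>) < 1 * (\<epsilon> * \<rho>)" using \<rho> \<epsilon> D by (intro mult_strict_right_mono) auto
  then have s_le: "8 * s < \<epsilon> * \<rho>" by (simp add: s_def)
  have \<epsilon>\<rho>: "\<epsilon> * \<rho> < \<rho>" "0 < \<epsilon> * \<rho>" using \<rho> \<epsilon> by auto
  obtain \<xi> where \<xi>: "\<xi> \<in> frontier D" "dist x \<xi> = \<rho>"
    using nearest_frontier_point[OF D(1,2) x] unfolding \<rho>_def by blast
  have "ennreal \<rho> < 2 * ediam (frontier D)"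
    using bdd
  proof
    assume "bounded D"
    have "ennreal \<rho> < ennreal (2 * \<rho>)" using \<rho> by (intro ennreal_lessI) auto
    also have "\<dots> \<le> 1 * ediam (frontier D)"
      using two_bdry_dist_le_ediam_frontier[OF D(1) \<open>bounded D\<close> x] by (simp add: \<rho>_def)
    also have "\<dots> \<le> 2 * ediam (frontier D)" by (intro mult_right_mono) auto
    finally show ?thesis .
  next
    assume "\<not> bounded (frontier D)"
    then show ?thesis by (simp add: ediam_unbounded ennreal_mult_top)
  qed
  then have cov: "C * (\<rho> / (\<epsilon> * \<rho>)) powr l \<le> real (card F)"
    if "finite F" "ball_cover (frontier D) (\<epsilon> * \<rho>) (ball \<xi> \<rho> \<inter> frontier D) F" for F
    using count \<xi>(1) \<epsilon>\<rho> that by blast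
  obtain F where F: "finite F" "F \<subseteq> ball \<xi> \<rho> \<inter> frontier D" "C * (\<rho> / (\<epsilon> * \<rho>)) powr l \<le> real (card F)"
    and sep: "\<And>v v'. v \<in> F \<Longrightarrow> v' \<in> F \<Longrightarrow> v \<noteq> v' \<Longrightarrow> \<epsilon> * \<rho> \<le> dist v v'"
  proof (rule separated_subset_of_cover_bound[OF \<epsilon>\<rho>(2) Int_lower2])
    fix F assume "finite F" "ball_cover (frontier D) (\<epsilon> * \<rho>) (ball \<xi> \<rho> \<inter> frontier D) F"
    then show "C * (\<rho> / (\<epsilon> * \<rho>)) powr l \<le> real (card F)" by (rule cov)
  qed (rule that)
  have "\<exists>z\<in>cball v (\<epsilon> * \<rho> / 4). ball z (2 * s) \<subseteq> D" if "v \<in> F" for v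
  proof -
    have "ennreal (\<epsilon> * \<rho> / 4) < ennreal (\<rho> / 2)" using \<epsilon>\<rho> \<rho> by (intro ennreal_lessI) auto
    also have "\<dots> \<le> ediam D" using \<rho> by (intro bdry_dist_le_ediam[OF D(1) x]) (auto simp: \<rho>_def)
    finally have "ennreal (\<epsilon> * \<rho> / 4) < ediam D" .
    moreover have "0 < \<epsilon> * \<rho> / 4" using \<epsilon>\<rho> by simp
    moreover have "v \<in> closure D" using that F(2) by (auto simp: frontier_def)
    ultimately have "\<exists>z\<in>cball v (\<epsilon> * \<rho> / 4). ball z (\<kappa> * (\<epsilon> * \<rho> / 4)) \<subseteq> D"
      using D(3) unfolding plump_def by blast
    then show ?thesis by (simp add: s_def mult_ac)
  qed
  then obtain z where z: "\<And>v. v \<in> F \<Longrightarrow> z v \<in> cball v (\<epsilon> * \<rho> / 4)" "\<And>v. v \<in> F \<Longrightarrow> ball (z v) (2 * s) \<subseteq> D"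
    by metis
  have near: "dist v y < \<epsilon> * \<rho> / 2" if "v \<in> F" "y \<in> ball (z v) s" for v y
  proof -
    have "dist v (z v) \<le> \<epsilon> * \<rho> / 4" "dist (z v) y < s" using z(1)[OF that(1)] that(2) by auto
    then show ?thesis using s_le s dist_triangle[of v y "z v"] by linarith
  qed
  have disj: "disjoint_family_on (\<lambda>v. ball (z v) s) F"
    unfolding disjoint_family_on_def
  proof (intro ballI impI)
    fix v v' assume v: "v \<in> F" "v' \<in> F" "v \<noteq> v'"
    show "ball (z v) s \<inter> ball (z v') s = {}"
    proof (rule ccontr)
      assume "ball (z v) s \<inter> ball (z v') s \<noteq> {}"
      then obtain y where y: "y \<in> ball (z v) s" "y \<in> ball (z v') s" by auto
      have "dist v v' < \<epsilon> * \<rho>"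
        using near[OF v(1) y(1)] near[OF v(2) y(2)] dist_triangle2[of v v' y] by simp
      then show False using sep[OF v] by simp
    qed
  qed
  have sub: "(\<Union>v\<in>F. ball (z v) s) \<subseteq> {y. (x, y) \<in> comparable_pairs D 3 (\<kappa> * \<epsilon> / 8) (\<epsilon> / 2)}"
  proof (intro UN_least subsetI CollectI)
    fix v y assume v: "v \<in> F" and y: "y \<in> ball (z v) s"
    have "ball (z v) s \<subseteq> ball (z v) (2 * s)" using s by (intro subset_ball) auto
    then have "y \<in> D" using y z(2)[OF v] by blast
    moreover have "s \<le> bdry_dist D y" by (rule bdry_dist_ge_half_radius[OF D(2) z(2)[OF v] y])
    moreover have "bdry_dist D y \<le> \<epsilon> / 2 * \<rho>"
      using bdry_dist_le_frontier[OF D(1), of v y] F(2) v near[OF v y] by (auto simp: dist_commute)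
    moreover have "dist x y < 3 * \<rho>"
      using near[OF v y] F(2) v \<xi>(2) \<epsilon>\<rho> dist_triangle[of x y \<xi>] dist_triangle[of \<xi> y v] by auto
    ultimately show "(x, y) \<in> comparable_pairs D 3 (\<kappa> * \<epsilon> / 8) (\<epsilon> / 2)"
      using x by (simp add: comparable_pairs_def \<rho>_def s_def)
  qed
  have "C * (1 / \<epsilon>) powr l * (unit_ball_vol DIM('a) * (\<kappa> * \<epsilon> / 8) ^ DIM('a)) * bdry_dist D x ^ DIM('a)
      = C * (\<rho> / (\<epsilon> * \<rho>)) powr l * (unit_ball_vol DIM('a) * s ^ DIM('a))"
    using \<rho> by (simp add: s_def \<rho>_def power_mult_distrib power_divide)
  also have "\<dots> \<le> real (card F) * (unit_ball_vol DIM('a) * s ^ DIM('a))"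
    using s by (intro mult_right_mono F(3)) (auto intro: mult_nonneg_nonneg less_imp_le unit_ball_vol_pos)
  finally have "ennreal (C * (1 / \<epsilon>) powr l * (unit_ball_vol DIM('a) * (\<kappa> * \<epsilon> / 8) ^ DIM('a)) * bdry_dist D x ^ DIM('a))
      \<le> ennreal (real (card F) * (unit_ball_vol DIM('a) * s ^ DIM('a)))" by (rule ennreal_leI)
  also have "\<dots> = (\<Sum>v\<in>F. emeasure lborel (ball (z v) s))"
    using s by (simp add: emeasure_ball ennreal_mult' ennreal_of_nat_eq_real_of_nat)
  also have "\<dots> = emeasure lborel (\<Union>v\<in>F. ball (z v) s)"
    by (intro sum_emeasure disj F(1)) auto
  also have "\<dots> \<le> emeasure lborel {y. (x, y) \<in> comparable_pairs D 3 (\<kappa> * \<epsilon> / 8) (\<epsilon> / 2)}"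
    by (intro emeasure_mono sub sets_comparable_pairs_sections D)
  finally show ?thesis .
qed

text \<open>In the thick case nothing better than a ball is needed here: the gain is in the number of partners
  of \<open>x\<close>.\<close>
lemma comparable_pairs_upper_volume:
  fixes D :: "'a::euclidean_space set"
  assumes "0 < \<alpha>" "0 < R"
  shows "emeasure lborel {x. (x, y) \<in> comparable_pairs D R \<alpha> \<beta>}
    \<le> ennreal (unit_ball_vol DIM('a) * (R / \<alpha>) ^ DIM('a) * bdry_dist D y ^ DIM('a))"
proof -
  have nn: "0 \<le> bdry_dist D y" by (simp add: bdry_dist_def infdist_nonneg)
  have "{x. (x, y) \<in> comparable_pairs D R \<alpha> \<beta>} \<subseteq> ball y (R / \<alpha> * bdry_dist D y)"
  proof
    fix x assume "x \<in> {x. (x, y) \<in> comparable_pairs D R \<alpha> \<beta>}"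
    then have *: "dist x y < R * bdry_dist D x" "\<alpha> * bdry_dist D x \<le> bdry_dist D y"
      by (auto simp: comparable_pairs_def)
    have "bdry_dist D x \<le> bdry_dist D y / \<alpha>" using * assms by (simp add: field_simps)
    then have "R * bdry_dist D x \<le> R * (bdry_dist D y / \<alpha>)" using assms by (intro mult_left_mono) auto
    then show "x \<in> ball y (R / \<alpha> * bdry_dist D y)" using * by (simp add: dist_commute)
  qed
  then have "emeasure lborel {x. (x, y) \<in> comparable_pairs D R \<alpha> \<beta>} \<le> emeasure lborel (ball y (R / \<alpha> * bdry_dist D y))"
    by (intro emeasure_mono) auto
  also have "\<dots> = ennreal (unit_ball_vol DIM('a) * (R / \<alpha>) ^ DIM('a) * bdry_dist D y ^ DIM('a))"
    using assms nn by (simp add: emeasure_ball power_mult_distrib power_divide)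
  finally show ?thesis .
qed

subsection \<open>Thin boundary\<close>

text \<open>An infinite diameter makes plumpness available at the scale \<open>\<rho> / \<epsilon>\<close>, however small \<open>\<epsilon>\<close> is.\<close>
lemma plump_unbounded_lower_volume:
  fixes D :: "'a::euclidean_space set"
  assumes D: "open D" "D \<noteq> UNIV" "plump \<kappa> D" "0 < \<kappa>" "\<kappa> < 1" "\<not> bounded D"
    and \<epsilon>: "0 < \<epsilon>" "\<epsilon> \<le> 1" and x: "x \<in> D"
  shows "ennreal (unit_ball_vol DIM('a) * (\<kappa> / (2 * \<epsilon>)) ^ DIM('a) * bdry_dist D x ^ DIM('a))
    \<le> emeasure lborel {y. (x, y) \<in> comparable_pairs D (2 / \<epsilon>) (\<kappa> / (2 * \<epsilon>)) (3 / \<epsilon>)}"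
proof -
  define \<rho> where "\<rho> = bdry_dist D x"
  have \<rho>: "0 < \<rho>" using D x unfolding \<rho>_def by (intro bdry_dist_pos)
  define s where "s = \<kappa> / (2 * \<epsilon>) * \<rho>"
  have s: "0 < s" using \<rho> \<epsilon> D by (simp add: s_def)
  have "\<kappa> * (\<rho> / \<epsilon>) < 1 * (\<rho> / \<epsilon>)" using \<rho> \<epsilon> D by (intro mult_strict_right_mono) auto
  then have s_le: "2 * s < \<rho> / \<epsilon>" by (simp add: s_def)
  have \<rho>_le: "\<rho> \<le> \<rho> / \<epsilon>" using \<rho> \<epsilon> by (simp add: field_simps)
  obtain z where z: "z \<in> cball x (\<rho> / \<epsilon>)" "ball z (\<kappa> * (\<rho> / \<epsilon>)) \<subseteq> D"
    using D(3) x \<rho> \<epsilon> closure_subset[of D] unfolding plump_def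
    by (metis D(6) divide_pos_pos ediam_unbounded ennreal_less_top subsetD)
  have z2: "ball z (2 * s) \<subseteq> D" using z(2) by (simp add: s_def)
  have sub: "ball z s \<subseteq> {y. (x, y) \<in> comparable_pairs D (2 / \<epsilon>) (\<kappa> / (2 * \<epsilon>)) (3 / \<epsilon>)}"
  proof (intro subsetI CollectI)
    fix y assume y: "y \<in> ball z s"
    have "ball z s \<subseteq> ball z (2 * s)" using s by (intro subset_ball) auto
    then have "y \<in> D" using y z2 by blast
    moreover have "s \<le> bdry_dist D y" by (rule bdry_dist_ge_half_radius[OF D(2) z2 y])
    moreover have d: "dist x y < 2 * (\<rho> / \<epsilon>)"
      using y z(1) s_le s dist_triangle[of x y z] by auto
    moreover have "bdry_dist D y \<le> 3 * (\<rho> / \<epsilon>)"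
      using d \<rho>_le bdry_dist_lipschitz[of D y x] by (simp add: \<rho>_def dist_commute)
    ultimately show "(x, y) \<in> comparable_pairs D (2 / \<epsilon>) (\<kappa> / (2 * \<epsilon>)) (3 / \<epsilon>)"
      using x by (simp add: comparable_pairs_def \<rho>_def s_def)
  qed
  have "ennreal (unit_ball_vol DIM('a) * (\<kappa> / (2 * \<epsilon>)) ^ DIM('a) * bdry_dist D x ^ DIM('a)) = emeasure lborel (ball z s)"
    using s by (simp add: emeasure_ball s_def \<rho>_def power_mult_distrib power_divide mult_ac)
  also have "\<dots> \<le> emeasure lborel {y. (x, y) \<in> comparable_pairs D (2 / \<epsilon>) (\<kappa> / (2 * \<epsilon>)) (3 / \<epsilon>)}"
    by (intro emeasure_mono sub sets_comparable_pairs_sections D)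
  finally show ?thesis .
qed

text \<open>The points paired with \<open>y\<close> have height at most \<open>2 * \<epsilon> * \<tau>\<close>, where \<open>\<tau>\<close> is the height of \<open>y\<close> over
  \<open>\<kappa>\<close>, and their nearest boundary points lie in a ball of radius \<open>7 * \<tau>\<close>. Cover the boundary there
  by balls of radius \<open>2 * \<epsilon> * \<tau>\<close>; the balls of twice that radius then cover the points themselves.\<close>
lemma thin_frontier_upper_volume:
  fixes D :: "'a::euclidean_space set"
  assumes D: "open D" "D \<noteq> UNIV" "0 < \<kappa>" "\<kappa> < 1"
    and \<epsilon>: "0 < \<epsilon>" "\<epsilon> \<le> 1" and "0 \<le> l" "0 < C"
    and count: "\<forall>r R. \<forall>x\<in>frontier D. 0 < r \<and> r < R \<and> ennreal R < 2 * ediam (frontier D) \<longrightarrow>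
        (\<exists>F. finite F \<and> ball_cover (frontier D) r (ball x R \<inter> frontier D) F \<and>
          real (card F) \<le> C * (R / r) powr l)"
    and y: "y \<in> D"
  shows "emeasure lborel {x. (x, y) \<in> comparable_pairs D (2 / \<epsilon>) (\<kappa> / (2 * \<epsilon>)) \<beta>}
    \<le> ennreal (max 1 C * (7 / (2 * \<epsilon>)) powr l * (unit_ball_vol DIM('a) * (4 * \<epsilon> / \<kappa>) ^ DIM('a)) * bdry_dist D y ^ DIM('a))"
proof -
  define \<tau> where "\<tau> = bdry_dist D y / \<kappa>"
  have \<tau>: "0 < \<tau>" using bdry_dist_pos[OF D(1,2) y] D by (simp add: \<tau>_def)
  have "bdry_dist D y \<le> \<tau>" using bdry_dist_pos[OF D(1,2) y] D by (simp add: \<tau>_def field_simps)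
  obtain \<xi> where \<xi>: "\<xi> \<in> frontier D" "dist y \<xi> = bdry_dist D y"
    using nearest_frontier_point[OF D(1,2) y] by blast
  have \<epsilon>\<tau>: "\<epsilon> * \<tau> \<le> \<tau>" "0 < \<epsilon> * \<tau>" using \<epsilon> \<tau> by auto
  then have "0 < 2 * (\<epsilon> * \<tau>)" "2 * (\<epsilon> * \<tau>) < 7 * \<tau>" using \<tau> by linarith+
  then obtain F where F: "finite F" "ball_cover (frontier D) (2 * (\<epsilon> * \<tau>)) (ball \<xi> (7 * \<tau>) \<inter> frontier D) F"
    "real (card F) \<le> max 1 C * (7 * \<tau> / (2 * (\<epsilon> * \<tau>))) powr l"
    using cover_bound_all_radii[OF \<open>0 \<le> l\<close> \<open>0 < C\<close> count \<xi>(1)] by blast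
  have sub: "{x. (x, y) \<in> comparable_pairs D (2 / \<epsilon>) (\<kappa> / (2 * \<epsilon>)) \<beta>} \<subseteq> (\<Union>v\<in>F. ball v (4 * (\<epsilon> * \<tau>)))"
  proof
    fix x assume "x \<in> {x. (x, y) \<in> comparable_pairs D (2 / \<epsilon>) (\<kappa> / (2 * \<epsilon>)) \<beta>}"
    then have x: "x \<in> D" "dist x y < 2 / \<epsilon> * bdry_dist D x" "\<kappa> / (2 * \<epsilon>) * bdry_dist D x \<le> bdry_dist D y"
      by (auto simp: comparable_pairs_def)
    have low: "bdry_dist D x \<le> 2 * (\<epsilon> * \<tau>)" using x(3) D \<epsilon> by (simp add: \<tau>_def field_simps)
    then have "2 / \<epsilon> * bdry_dist D x \<le> 2 / \<epsilon> * (2 * (\<epsilon> * \<tau>))" using \<epsilon> by (intro mult_left_mono) auto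
    then have "dist x y < 4 * \<tau>" using x(2) \<epsilon> by simp
    obtain \<zeta> where \<zeta>: "\<zeta> \<in> frontier D" "dist x \<zeta> = bdry_dist D x"
      using nearest_frontier_point[OF D(1,2) x(1)] by blast
    have "dist \<xi> \<zeta> < 7 * \<tau>"
      using \<zeta>(2) \<xi>(2) low \<epsilon>\<tau> \<open>dist x y < 4 * \<tau>\<close> \<open>bdry_dist D y \<le> \<tau>\<close>
        dist_triangle[of \<xi> \<zeta> y] dist_triangle[of y \<zeta> x] by (simp add: dist_commute)
    then obtain v where v: "v \<in> F" "dist v \<zeta> < 2 * (\<epsilon> * \<tau>)"
      using F(2) \<zeta>(1) unfolding ball_cover_def by auto
    have "dist v x < 4 * (\<epsilon> * \<tau>)"
      using v(2) \<zeta>(2) low dist_triangle[of v x \<zeta>] by (simp add: dist_commute)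
    then show "x \<in> (\<Union>v\<in>F. ball v (4 * (\<epsilon> * \<tau>)))" using v(1) by auto
  qed
  have "emeasure lborel {x. (x, y) \<in> comparable_pairs D (2 / \<epsilon>) (\<kappa> / (2 * \<epsilon>)) \<beta>}
      \<le> emeasure lborel (\<Union>v\<in>F. ball v (4 * (\<epsilon> * \<tau>)))"
    using F(1) by (intro emeasure_mono sub) auto
  also have "\<dots> \<le> (\<Sum>v\<in>F. emeasure lborel (ball v (4 * (\<epsilon> * \<tau>))))"
    by (intro emeasure_subadditive_finite F(1)) auto
  also have "\<dots> = ennreal (real (card F) * (unit_ball_vol DIM('a) * (4 * (\<epsilon> * \<tau>)) ^ DIM('a)))"
    using \<epsilon>\<tau> by (simp add: emeasure_ball ennreal_mult' ennreal_of_nat_eq_real_of_nat)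
  also have "\<dots> \<le> ennreal (max 1 C * (7 * \<tau> / (2 * (\<epsilon> * \<tau>))) powr l * (unit_ball_vol DIM('a) * (4 * (\<epsilon> * \<tau>)) ^ DIM('a)))"
    using \<epsilon>\<tau> by (intro ennreal_leI mult_right_mono F(3)) (auto intro: mult_nonneg_nonneg less_imp_le unit_ball_vol_pos)
  also have "7 * \<tau> / (2 * (\<epsilon> * \<tau>)) = 7 / (2 * \<epsilon>)" using \<tau> by simp
  also have "(4 * (\<epsilon> * \<tau>)) ^ DIM('a) = (4 * \<epsilon> / \<kappa>) ^ DIM('a) * bdry_dist D y ^ DIM('a)"
    by (simp add: \<tau>_def power_mult_distrib power_divide)
  finally show ?thesis by (simp only: mult.assoc)
qed

section \<open>The inequality\<close>

definition fractional_hardy ::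
    "'a::euclidean_space set \<Rightarrow> real \<Rightarrow> (real \<Rightarrow> real) \<Rightarrow> real \<Rightarrow> real \<Rightarrow> bool" where
  "fractional_hardy D p \<phi> c R \<longleftrightarrow> (\<forall>u :: 'a \<Rightarrow> real.
    u \<in> borel_measurable (lebesgue_on D) \<and>
    (\<integral>\<^sup>+x\<in>D. ennreal (\<bar>u x\<bar> powr p / \<phi> (bdry_dist D x)) \<partial>lebesgue) < \<infinity> \<longrightarrow>
    (\<integral>\<^sup>+x\<in>D. ennreal (\<bar>u x\<bar> powr p / \<phi> (bdry_dist D x)) \<partial>lebesgue)
      \<le> ennreal c *
        (\<integral>\<^sup>+x\<in>D. (\<integral>\<^sup>+y\<in>D \<inter> ball x (R * bdry_dist D x).
            ennreal (\<bar>u x - u y\<bar> powr p / (\<phi> (bdry_dist D x) * bdry_dist D x ^ DIM('a)))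
          \<partial>lebesgue) \<partial>lebesgue))"

text \<open>The reduction to geometry: it remains to bound the volumes of the two sections of the set of pairs
  and the ratio of the weights, so that \<open>K * \<beta> ^ n * m\<close> is small compared to \<open>a\<close>. The factor \<open>\<beta> ^ n\<close>
  appears because the average in \<open>x\<close> is normalised by the height of \<open>x\<close>, but the volume bound for
  the points paired with \<open>y\<close> is expressed by the height of \<open>y\<close>.\<close>
lemma fractional_hardy_of_section_bounds:
  fixes D :: "'a::euclidean_space set" and \<phi> :: "real \<Rightarrow> real" and R \<alpha> \<beta> :: real
  defines "P \<equiv> comparable_pairs D R \<alpha> \<beta>"
  assumes D: "open D" "D \<noteq> UNIV" and "0 < p" "0 < H" "0 < a" "0 \<le> m" "0 \<le> K" "0 < \<beta>"
    and \<phi>: "\<And>s. 0 < s \<Longrightarrow> 0 < \<phi> s"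
    and \<psi>: "\<psi> \<in> borel_measurable borel" "\<And>s. 0 < s \<Longrightarrow> \<phi> s \<le> \<psi> s" "\<And>s. 0 < s \<Longrightarrow> \<psi> s \<le> \<phi> s / H"
    and comparable: "\<And>s t. 0 < s \<Longrightarrow> \<alpha> * s \<le> t \<Longrightarrow> t \<le> \<beta> * s \<Longrightarrow> \<phi> t \<le> K * \<phi> s"
    and lower: "\<And>x. x \<in> D \<Longrightarrow> ennreal (a * bdry_dist D x ^ DIM('a)) \<le> emeasure lborel {y. (x, y) \<in> P}"
    and upper: "\<And>y. y \<in> D \<Longrightarrow> emeasure lborel {x. (x, y) \<in> P} \<le> ennreal (m * bdry_dist D y ^ DIM('a))"
    and small: "2 powr p * (K / H * \<beta> ^ DIM('a) * m) \<le> a / 2"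
  shows "fractional_hardy D p \<phi> (2 * 2 powr p / a / H) R"
  unfolding fractional_hardy_def
proof (intro allI impI, elim conjE)
  fix u :: "'a \<Rightarrow> real"
  let ?d = "bdry_dist D"
  let ?L = "\<integral>\<^sup>+x\<in>D. ennreal (\<bar>u x\<bar> powr p / \<phi> (?d x)) \<partial>lebesgue"
  let ?E = "\<integral>\<^sup>+x\<in>D. (\<integral>\<^sup>+y\<in>D \<inter> ball x (R * ?d x).
            ennreal (\<bar>u x - u y\<bar> powr p / (\<phi> (?d x) * ?d x ^ DIM('a))) \<partial>lebesgue) \<partial>lebesgue"
  assume u: "u \<in> borel_measurable (lebesgue_on D)" and finite: "?L < \<infinity>"
  note [measurable] = \<psi>(1)
  have [measurable]: "D \<in> sets borel" using D by auto
  have pos: "0 < ?d x" if "x \<in> D" for x using bdry_dist_pos[OF D that] .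
  have \<psi>_pos: "0 < \<psi> (?d x)" if "x \<in> D" for x
    using \<phi>[OF pos[OF that]] \<psi>(2)[OF pos[OF that]] by linarith
  have PD: "P \<subseteq> D \<times> D" by (auto simp: P_def comparable_pairs_def)
  have P_sets [measurable]: "P \<in> sets (lborel \<Otimes>\<^sub>M lborel)"
    unfolding P_def by (rule sets_comparable_pairs[OF D(1)])
  \<comment> \<open>Tonelli's theorem is applied to a Borel representative of \<open>u\<close>; neither side of the inequality
      changes on passing to it.\<close>
  have "(\<lambda>x. if x \<in> D then u x else 0) \<in> borel_measurable lebesgue"
    using u by (rule borel_measurable_if_I) simp
  then obtain v where v [measurable]: "v \<in> borel_measurable lborel"
    and "AE x in lborel. (if x \<in> D then u x else 0) = v x"
    using completion_ex_borel_measurable_real by blast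
  then have uv: "AE x in lborel. x \<in> D \<longrightarrow> u x = v x" by (auto elim!: eventually_mono)
  define w where "w x = 1 / \<psi> (?d x)" for x
  have w [measurable]: "w \<in> borel_measurable lborel" unfolding w_def by measurable
  have w_pos: "0 < w x" if "x \<in> D" for x using \<psi>_pos[OF that] by (simp add: w_def)
  have w_le: "w x \<le> 1 / \<phi> (?d x)" if "x \<in> D" for x
    using \<psi>(2)[OF pos[OF that]] \<phi>[OF pos[OF that]] \<psi>_pos[OF that] by (simp add: w_def field_simps)
  have w_ge: "1 / \<phi> (?d x) \<le> 1 / H * w x" if "x \<in> D" for x
    using \<psi>(3)[OF pos[OF that]] \<phi>[OF pos[OF that]] \<psi>_pos[OF that] \<open>0 < H\<close>
    by (simp add: w_def field_simps)
  have mult_w_le: "c * w x \<le> c / \<phi> (?d x)" if "x \<in> D" "0 \<le> c" for c x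
    using mult_left_mono[OF w_le[OF that(1)] that(2)] by simp
  have mult_w_ge: "c / \<phi> (?d x) \<le> 1 / H * (c * w x)" if "x \<in> D" "0 \<le> c" for c x
    using mult_left_mono[OF w_ge[OF that(1)] that(2)] by simp
  let ?I = "\<integral>\<^sup>+x\<in>D. ennreal (\<bar>v x\<bar> powr p * w x) \<partial>lborel"
  let ?J = "\<integral>\<^sup>+x. \<integral>\<^sup>+y. ennreal (\<bar>v x - v y\<bar> powr p * (w x / ?d x ^ DIM('a))) * indicator P (x, y) \<partial>lborel \<partial>lborel"
  have "?L \<le> (\<integral>\<^sup>+x. ennreal (1 / H) * (ennreal (\<bar>v x\<bar> powr p * w x) * indicator D x) \<partial>lborel)"
    unfolding nn_integral_completion
  proof (rule nn_integral_mono_AE, use uv in eventually_elim)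
    case (elim x)
    show ?case
    proof (cases "x \<in> D")
      case True
      have "ennreal (\<bar>v x\<bar> powr p / \<phi> (?d x)) \<le> ennreal (1 / H * (\<bar>v x\<bar> powr p * w x))"
        by (intro ennreal_leI mult_w_ge True) simp
      also have "\<dots> = ennreal (1 / H) * ennreal (\<bar>v x\<bar> powr p * w x)"
        using \<open>0 < H\<close> w_pos[OF True] by (intro ennreal_mult) auto
      finally show ?thesis using True elim by simp
    qed simp
  qed
  also have "\<dots> = ennreal (1 / H) * ?I" by (rule nn_integral_cmult) measurable
  finally have LI: "?L \<le> ennreal (1 / H) * ?I" .
  have "?I \<le> ?L"
    unfolding nn_integral_completion
  proof (rule nn_integral_mono_AE, use uv in eventually_elim)
    case (elim x)
    then show ?case
      by (cases "x \<in> D") (auto intro!: ennreal_leI mult_w_le)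
  qed
  then have I_finite: "?I < \<infinity>" using finite by (rule le_less_trans)
  have transfer: "(\<integral>\<^sup>+x. ennreal (w x / ?d x ^ DIM('a)) * indicator P (x, y) \<partial>lborel)
      \<le> ennreal (K / H * \<beta> ^ DIM('a) * m * w y)" if y: "y \<in> D" for y
  proof -
    let ?q = "K / H * w y * (\<beta> ^ DIM('a) / ?d y ^ DIM('a))"
    have "w x / ?d x ^ DIM('a) \<le> ?q" if "(x, y) \<in> P" for x
    proof -
      have x: "x \<in> D" and h: "\<alpha> * ?d x \<le> ?d y" "?d y \<le> \<beta> * ?d x"
        using that by (auto simp: P_def comparable_pairs_def)
      have "w x \<le> 1 / \<phi> (?d x)" by (rule w_le[OF x])
      also have "\<dots> \<le> K * (1 / \<phi> (?d y))"
        using comparable[OF pos[OF x] h] \<phi>[OF pos[OF x]] \<phi>[OF pos[OF y]] by (simp add: field_simps)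
      also have "\<dots> \<le> K * (1 / H * w y)" by (intro mult_left_mono w_ge y \<open>0 \<le> K\<close>)
      finally have 1: "w x \<le> K / H * w y" by simp
      have "?d y / \<beta> \<le> ?d x" using h \<open>0 < \<beta>\<close> by (simp add: field_simps)
      then have "(?d y / \<beta>) ^ DIM('a) \<le> ?d x ^ DIM('a)"
        using pos[OF y] \<open>0 < \<beta>\<close> by (intro power_mono) auto
      then have "1 / ?d x ^ DIM('a) \<le> 1 / (?d y / \<beta>) ^ DIM('a)"
        using pos[OF y] pos[OF x] \<open>0 < \<beta>\<close> by (intro divide_left_mono) auto
      then have "w x * (1 / ?d x ^ DIM('a)) \<le> (K / H * w y) * (1 / (?d y / \<beta>) ^ DIM('a))"
        using 1 pos[OF x] w_pos[OF y] w_pos[OF x] \<open>0 < H\<close> \<open>0 \<le> K\<close> by (intro mult_mono) auto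
      then show ?thesis by (simp add: power_divide)
    qed
    then have "(\<integral>\<^sup>+x. ennreal (w x / ?d x ^ DIM('a)) * indicator P (x, y) \<partial>lborel)
        \<le> (\<integral>\<^sup>+x. ennreal ?q * indicator {x. (x, y) \<in> P} x \<partial>lborel)"
      by (intro nn_integral_mono) (auto simp: indicator_def intro!: ennreal_leI)
    also have "\<dots> = ennreal ?q * emeasure lborel {x. (x, y) \<in> P}"
      using sets_comparable_pairs_sections(2)[OF D(1)] unfolding P_def
      by (intro nn_integral_cmult_indicator)
    also have "\<dots> \<le> ennreal ?q * ennreal (m * ?d y ^ DIM('a))"
      by (intro mult_left_mono upper y) simp
    also have "\<dots> = ennreal (?q * (m * ?d y ^ DIM('a)))"
      using w_pos[OF y] pos[OF y] \<open>0 < H\<close> \<open>0 \<le> K\<close> \<open>0 \<le> m\<close> \<open>0 < \<beta>\<close> by (intro ennreal_mult[symmetric]) auto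
    also have "?q * (m * ?d y ^ DIM('a)) = K / H * \<beta> ^ DIM('a) * m * w y"
      using pos[OF y] by simp
    finally show ?thesis .
  qed
  have IJ: "?I \<le> ennreal (2 * 2 powr p / a) * ?J"
    using P_sets _ v w _ PD \<open>0 < p\<close> \<open>0 < a\<close> _ small _ _ lower transfer I_finite
    by (rule nn_integral_le_differences_by_absorption)
      (use w_pos pos \<open>0 < H\<close> \<open>0 \<le> K\<close> \<open>0 \<le> m\<close> \<open>0 < \<beta>\<close> in \<open>auto intro: less_imp_le\<close>)
  have "?J \<le> ?E"
    unfolding nn_integral_completion
  proof (rule nn_integral_mono_AE, use uv in eventually_elim)
    case (elim x)
    show ?case
    proof (cases "x \<in> D")
      case True
      have "(\<integral>\<^sup>+y. ennreal (\<bar>v x - v y\<bar> powr p * (w x / ?d x ^ DIM('a))) * indicator P (x, y) \<partial>lborel)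
        \<le> (\<integral>\<^sup>+y\<in>D \<inter> ball x (R * ?d x). ennreal (\<bar>u x - u y\<bar> powr p / (\<phi> (?d x) * ?d x ^ DIM('a))) \<partial>lborel)"
      proof (rule nn_integral_mono_AE, use uv in eventually_elim)
        case (elim y)
        show ?case
        proof (cases "(x, y) \<in> P")
          case True
          then have xy: "x \<in> D" "y \<in> D \<inter> ball x (R * ?d x)" by (auto simp: P_def comparable_pairs_def)
          have "\<bar>u x - u y\<bar> powr p / ?d x ^ DIM('a) * w x \<le> \<bar>u x - u y\<bar> powr p / ?d x ^ DIM('a) / \<phi> (?d x)"
            using pos[OF xy(1)] by (intro mult_w_le xy) simp
          then have "ennreal (\<bar>u x - u y\<bar> powr p * (w x / ?d x ^ DIM('a)))
              \<le> ennreal (\<bar>u x - u y\<bar> powr p / (\<phi> (?d x) * ?d x ^ DIM('a)))"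
            by (intro ennreal_leI) (simp add: mult.commute)
          then show ?thesis using True xy elim \<open>x \<in> D \<longrightarrow> u x = v x\<close> by simp
        qed simp
      qed
      then show ?thesis using True by simp
    next
      case False
      then have "indicator P (x, y) = (0::ennreal)" for y using PD by (auto simp: indicator_def)
      then show ?thesis by simp
    qed
  qed
  have "?L \<le> ennreal (1 / H) * (ennreal (2 * 2 powr p / a) * ?E)"
    by (rule order_trans[OF LI mult_left_mono[OF order_trans[OF IJ mult_left_mono[OF \<open>?J \<le> ?E\<close>]]]]) auto
  also have "\<dots> = ennreal (2 * 2 powr p / a / H) * ?E"
    using \<open>0 < H\<close> \<open>0 < a\<close> by (simp add: mult.assoc[symmetric] ennreal_mult[symmetric] mult.commute)
  finally show "?L \<le> ennreal (2 * 2 powr p / a / H) * ?E" .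
qed

lemma exists_small_power_le:
  fixes X Y \<epsilon>0 s t :: real
  assumes "0 \<le> X" "0 < Y" "0 < \<epsilon>0" "t < s"
  obtains \<epsilon> where "0 < \<epsilon>" "\<epsilon> \<le> \<epsilon>0" "X * \<epsilon> powr s \<le> Y * \<epsilon> powr t"
proof
  define \<epsilon> where "\<epsilon> = min \<epsilon>0 ((Y / (X + 1)) powr (1 / (s - t)))"
  show pos: "0 < \<epsilon>" using assms by (simp add: \<epsilon>_def)
  show "\<epsilon> \<le> \<epsilon>0" by (simp add: \<epsilon>_def)
  have "\<epsilon> powr (s - t) \<le> ((Y / (X + 1)) powr (1 / (s - t))) powr (s - t)"
    using assms pos by (intro powr_mono2) (auto simp: \<epsilon>_def)
  also have "\<dots> = Y / (X + 1)" using assms by (simp add: powr_powr)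
  finally have "(X + 1) * \<epsilon> powr (s - t) \<le> Y" using assms by (simp add: field_simps)
  moreover have "X * \<epsilon> powr (s - t) \<le> (X + 1) * \<epsilon> powr (s - t)" by (intro mult_right_mono) auto
  ultimately have "X * \<epsilon> powr (s - t) \<le> Y" by linarith
  then have "X * \<epsilon> powr (s - t) * \<epsilon> powr t \<le> Y * \<epsilon> powr t" by (intro mult_right_mono) auto
  moreover have "\<epsilon> powr (s - t) * \<epsilon> powr t = \<epsilon> powr s" by (simp flip: powr_add)
  ultimately show "X * \<epsilon> powr s \<le> Y * \<epsilon> powr t" by (simp add: mult.assoc)
qed

lemma powr_le_sum_of_endpoints:
  fixes r :: real
  assumes "0 < \<alpha>" "\<alpha> \<le> r" "r \<le> \<beta>"
  shows "r powr \<eta> \<le> \<alpha> powr \<eta> + \<beta> powr \<eta>"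
proof (cases "0 \<le> \<eta>")
  case True
  then have "r powr \<eta> \<le> \<beta> powr \<eta>" using assms by (intro powr_mono2) auto
  then show ?thesis by (simp add: add_increasing)
next
  case False
  then have "r powr \<eta> \<le> \<alpha> powr \<eta>" using assms by (intro powr_mono2') auto
  then show ?thesis by (simp add: add_increasing2)
qed

lemma comparable_of_scaling:
  fixes \<phi> :: "real \<Rightarrow> real"
  assumes scaling: "\<phi> t \<le> (t / s) powr \<eta> / H * \<phi> s"
    and "0 < H" "0 < \<alpha>" "0 < s" "\<alpha> * s \<le> t" "t \<le> \<beta> * s" "0 < \<phi> s"
  shows "\<phi> t \<le> (\<alpha> powr \<eta> + \<beta> powr \<eta>) / H * \<phi> s"
proof -
  have "(t / s) powr \<eta> \<le> \<alpha> powr \<eta> + \<beta> powr \<eta>"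
    by (intro powr_le_sum_of_endpoints) (use assms in \<open>auto simp: field_simps\<close>)
  then have "(t / s) powr \<eta> / H * \<phi> s \<le> (\<alpha> powr \<eta> + \<beta> powr \<eta>) / H * \<phi> s"
    using assms by (intro mult_right_mono divide_right_mono) auto
  with scaling show ?thesis by linarith
qed

text \<open>The absorbed factor is a constant times \<open>\<epsilon> powr (\<eta> + l - n)\<close>. The lower Assouad dimension is a
  supremum, so some admissible exponent \<open>l\<close> makes the power positive.\<close>
lemma fractional_hardy_thick:
  fixes D :: "'a::euclidean_space set" and \<phi> :: "real \<Rightarrow> real"
  assumes D: "open D" "D \<noteq> UNIV" "plump \<kappa> D" and \<kappa>: "0 < \<kappa>" "\<kappa> < 1" and "0 < p" "0 < H"
    and \<phi>: "\<And>s. 0 < s \<Longrightarrow> 0 < \<phi> s" and scaling: "WLSC \<eta> H \<phi>"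
    and bdd: "bounded D \<or> \<not> bounded (frontier D)"
    and dim: "ereal (real DIM('a) - \<eta>) < lower_Assouad_dim (frontier D)"
  shows "\<exists>c>0. \<exists>R>0. fractional_hardy D p \<phi> c R"
proof -
  let ?n = "DIM('a)" and ?V = "unit_ball_vol DIM('a)"
  have V: "0 < ?V" by (rule unit_ball_vol_pos) simp
  obtain l C where l: "real ?n - \<eta> < l" and "0 < C" and
    count: "\<forall>r R. \<forall>x\<in>frontier D. 0 < r \<and> r < R \<and> ennreal R < 2 * ediam (frontier D) \<longrightarrow>
        (\<forall>F. finite F \<and> ball_cover (frontier D) r (ball x R \<inter> frontier D) F \<longrightarrow>
          C * (R / r) powr l \<le> real (card F))"
    using dim unfolding lower_Assouad_dim_def less_Sup_iff by auto
  obtain \<psi> where \<psi>: "\<psi> \<in> borel_measurable borel"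
    "\<And>s. 0 < s \<Longrightarrow> \<phi> s \<le> \<psi> s" "\<And>s. 0 < s \<Longrightarrow> \<psi> s \<le> \<phi> s / H"
    using scaling_imp_comparable_borel[OF \<open>0 < H\<close>, of \<phi> \<eta>] \<phi> scaling by auto
  \<comment> \<open>\<open>X\<close> and \<open>Y\<close> collect what does not depend on \<open>\<epsilon>\<close> on the two sides of the smallness condition of
      \<open>fractional_hardy_of_section_bounds\<close>.\<close>
  define X where "X = 2 powr p * (((\<kappa> / 8) powr \<eta> + (1 / 2) powr \<eta>) / H / H * (12 / \<kappa>) ^ ?n * ?V)"
  define Y where "Y = C * (?V * (\<kappa> / 8) ^ ?n) / 2"
  have "0 \<le> X" "0 < Y" using V \<kappa> \<open>0 < H\<close> \<open>0 < C\<close> by (auto simp: X_def Y_def)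
  moreover have "real ?n - l < \<eta>" using l by simp
  ultimately obtain \<epsilon> where \<epsilon>: "0 < \<epsilon>" "\<epsilon> \<le> 1 / 2" and small: "X * \<epsilon> powr \<eta> \<le> Y * \<epsilon> powr (real ?n - l)"
    using exists_small_power_le[of X Y "1 / 2" "real ?n - l" \<eta>] by auto
  define \<alpha> \<beta> where "\<alpha> = \<kappa> * \<epsilon> / 8" and "\<beta> = \<epsilon> / 2"
  define K where "K = (\<alpha> powr \<eta> + \<beta> powr \<eta>) / H"
  define a where "a = C * (1 / \<epsilon>) powr l * (?V * (\<kappa> * \<epsilon> / 8) ^ ?n)"
  define m where "m = ?V * (3 / \<alpha>) ^ ?n"
  have pos: "0 < \<alpha>" "0 < \<beta>" "0 \<le> K" "0 < a" "0 \<le> m"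
    using \<epsilon> \<kappa> V \<open>0 < H\<close> \<open>0 < C\<close> by (auto simp: \<alpha>_def \<beta>_def K_def a_def m_def)
  have "fractional_hardy D p \<phi> (2 * 2 powr p / a / H) 3"
  proof (rule fractional_hardy_of_section_bounds[OF D(1,2) \<open>0 < p\<close> \<open>0 < H\<close> pos(4,5,3,2) \<phi> \<psi>])
    show "\<phi> t \<le> K * \<phi> s" if "0 < s" "\<alpha> * s \<le> t" "t \<le> \<beta> * s" for s t
      unfolding K_def
    proof (rule comparable_of_scaling[where \<phi> = \<phi>, OF _ \<open>0 < H\<close> pos(1) that \<phi>[OF that(1)]])
      \<comment> \<open>Partners are lower than \<open>x\<close>, the direction in which WLSC compares.\<close>
      have "0 < \<alpha> * s" using pos that by simp
      moreover have "\<beta> * s \<le> 1 * s" using that \<epsilon> by (intro mult_right_mono) (auto simp: \<beta>_def)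
      ultimately show "\<phi> t \<le> (t / s) powr \<eta> / H * \<phi> s"
        using that by (intro WLSC_scaling[OF scaling \<open>0 < H\<close>]) linarith+
    qed
    show "ennreal (a * bdry_dist D x ^ ?n) \<le> emeasure lborel {y. (x, y) \<in> comparable_pairs D 3 \<alpha> \<beta>}"
      if "x \<in> D" for x
      unfolding a_def \<alpha>_def \<beta>_def
      using \<epsilon> by (intro thick_frontier_lower_volume[OF D \<kappa> bdd _ _ \<open>0 < C\<close> count that]) auto
    show "emeasure lborel {x. (x, y) \<in> comparable_pairs D 3 \<alpha> \<beta>} \<le> ennreal (m * bdry_dist D y ^ ?n)" for y
      unfolding m_def by (rule comparable_pairs_upper_volume) (use pos in auto)
    have "2 powr p * (K / H * \<beta> ^ ?n * m) = X * \<epsilon> powr \<eta>"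
    proof -
      have "\<beta> ^ ?n * (3 / \<alpha>) ^ ?n = (12 / \<kappa>) ^ ?n"
        using \<epsilon> \<kappa> by (simp add: \<alpha>_def \<beta>_def flip: power_mult_distrib)
      moreover have "K = ((\<kappa> / 8) powr \<eta> + (1 / 2) powr \<eta>) / H * \<epsilon> powr \<eta>"
        using \<epsilon> \<kappa> powr_mult[of "\<kappa> / 8" \<epsilon> \<eta>] powr_mult[of "1 / 2" \<epsilon> \<eta>]
        by (simp add: K_def \<alpha>_def \<beta>_def add_divide_distrib distrib_right)
      ultimately show ?thesis by (simp add: X_def m_def mult_ac)
    qed
    also note small
    also have "Y * \<epsilon> powr (real ?n - l) = a / 2"
      using \<epsilon> by (simp add: Y_def a_def powr_diff powr_realpow powr_divide power_mult_distrib power_divide mult_ac)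
    finally show "2 powr p * (K / H * \<beta> ^ ?n * m) \<le> a / 2" .
  qed
  moreover have "0 < 2 * 2 powr p / a / H" using pos \<open>0 < H\<close> by simp
  ultimately show ?thesis by (metis zero_less_numeral)
qed

text \<open>The absorbed factor is a constant times \<open>\<epsilon> powr (n - \<eta> - l)\<close>, with an admissible exponent \<open>l\<close>
  of the upper Assouad dimension that makes the power positive.\<close>
lemma fractional_hardy_thin:
  fixes D :: "'a::euclidean_space set" and \<phi> :: "real \<Rightarrow> real"
  assumes D: "open D" "D \<noteq> UNIV" "plump \<kappa> D" and \<kappa>: "0 < \<kappa>" "\<kappa> < 1" and "0 < p" "0 < H"
    and \<phi>: "\<And>s. 0 < s \<Longrightarrow> 0 < \<phi> s" and scaling: "WUSC \<eta> (inverse H) \<phi>"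
    and "\<not> bounded D"
    and dim: "upper_Assouad_dim (frontier D) < ereal (real DIM('a) - \<eta>)"
  shows "\<exists>c>0. \<exists>R>0. fractional_hardy D p \<phi> c R"
proof -
  let ?n = "DIM('a)" and ?V = "unit_ball_vol DIM('a)"
  have V: "0 < ?V" by (rule unit_ball_vol_pos) simp
  obtain l C where l: "l < real ?n - \<eta>" "0 \<le> l" and "0 < C" and
    count: "\<forall>r R. \<forall>x\<in>frontier D. 0 < r \<and> r < R \<and> ennreal R < 2 * ediam (frontier D) \<longrightarrow>
        (\<exists>F. finite F \<and> ball_cover (frontier D) r (ball x R \<inter> frontier D) F \<and>
          real (card F) \<le> C * (R / r) powr l)"
    using dim unfolding upper_Assouad_dim_def Inf_less_iff by auto
  obtain \<psi> where \<psi>: "\<psi> \<in> borel_measurable borel"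
    "\<And>s. 0 < s \<Longrightarrow> \<phi> s \<le> \<psi> s" "\<And>s. 0 < s \<Longrightarrow> \<psi> s \<le> \<phi> s / H"
    using scaling_imp_comparable_borel[OF \<open>0 < H\<close>, of \<phi> \<eta>] \<phi> scaling by auto
  \<comment> \<open>\<open>X\<close> and \<open>Y\<close> collect what does not depend on \<open>\<epsilon>\<close> on the two sides of the smallness condition of
      \<open>fractional_hardy_of_section_bounds\<close>.\<close>
  define X where "X = 2 powr p * (((\<kappa> / 2) powr \<eta> + 3 powr \<eta>) / H / H * 3 ^ ?n *
    (max 1 C * (7 / 2) powr l * (?V * (4 / \<kappa>) ^ ?n)))"
  define Y where "Y = ?V * (\<kappa> / 2) ^ ?n / 2"
  have "0 \<le> X" "0 < Y" using V \<kappa> \<open>0 < H\<close> \<open>0 < C\<close> by (auto simp: X_def Y_def)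
  moreover have "- real ?n < - \<eta> - l" using l by simp
  moreover have "0 < \<kappa> / 2" using \<kappa> by simp
  ultimately obtain \<epsilon> where \<epsilon>: "0 < \<epsilon>" "\<epsilon> \<le> \<kappa> / 2" and small: "X * \<epsilon> powr (- \<eta> - l) \<le> Y * \<epsilon> powr (- real ?n)"
    using exists_small_power_le[of X Y "\<kappa> / 2" "- real ?n" "- \<eta> - l"] by auto
  have \<epsilon>1: "\<epsilon> \<le> 1" using \<epsilon> \<kappa> by simp
  define \<alpha> \<beta> where "\<alpha> = \<kappa> / (2 * \<epsilon>)" and "\<beta> = 3 / \<epsilon>"
  define K where "K = (\<alpha> powr \<eta> + \<beta> powr \<eta>) / H"
  define a where "a = ?V * (\<kappa> / (2 * \<epsilon>)) ^ ?n"
  define m where "m = max 1 C * (7 / (2 * \<epsilon>)) powr l * (?V * (4 * \<epsilon> / \<kappa>) ^ ?n)"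
  have pos: "0 < \<alpha>" "0 < \<beta>" "0 \<le> K" "0 < a" "0 \<le> m"
    using \<epsilon> \<kappa> V \<open>0 < H\<close> \<open>0 < C\<close> by (auto simp: \<alpha>_def \<beta>_def K_def a_def m_def)
  have "fractional_hardy D p \<phi> (2 * 2 powr p / a / H) (2 / \<epsilon>)"
  proof (rule fractional_hardy_of_section_bounds[OF D(1,2) \<open>0 < p\<close> \<open>0 < H\<close> pos(4,5,3,2) \<phi> \<psi>])
    show "\<phi> t \<le> K * \<phi> s" if "0 < s" "\<alpha> * s \<le> t" "t \<le> \<beta> * s" for s t
      unfolding K_def
    proof (rule comparable_of_scaling[where \<phi> = \<phi>, OF _ \<open>0 < H\<close> pos(1) that \<phi>[OF that(1)]])
      \<comment> \<open>The bound \<open>\<epsilon> \<le> \<kappa> / 2\<close> makes partners at least as high as \<open>x\<close>, the direction in which WUSC compares.\<close>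
      have "1 \<le> \<alpha>" using \<epsilon> by (simp add: \<alpha>_def field_simps)
      then have "1 * s \<le> \<alpha> * s" using that by (intro mult_right_mono) auto
      then show "\<phi> t \<le> (t / s) powr \<eta> / H * \<phi> s"
        using that by (intro WUSC_scaling[OF scaling \<open>0 < H\<close>]) linarith+
    qed
    show "ennreal (a * bdry_dist D x ^ ?n) \<le> emeasure lborel {y. (x, y) \<in> comparable_pairs D (2 / \<epsilon>) \<alpha> \<beta>}"
      if "x \<in> D" for x
      unfolding a_def \<alpha>_def \<beta>_def
      by (rule plump_unbounded_lower_volume[OF D \<kappa> \<open>\<not> bounded D\<close> \<epsilon>(1) \<epsilon>1 that])
    show "emeasure lborel {x. (x, y) \<in> comparable_pairs D (2 / \<epsilon>) \<alpha> \<beta>} \<le> ennreal (m * bdry_dist D y ^ ?n)"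
      if "y \<in> D" for y
      unfolding m_def \<alpha>_def
      by (rule thin_frontier_upper_volume[OF D(1,2) \<kappa> \<epsilon>(1) \<epsilon>1 \<open>0 \<le> l\<close> \<open>0 < C\<close> count that])
    have "2 powr p * (K / H * \<beta> ^ ?n * m) = X * \<epsilon> powr (- \<eta> - l)"
    proof -
      have "\<beta> ^ ?n * (4 * \<epsilon> / \<kappa>) ^ ?n = 3 ^ ?n * (4 / \<kappa>) ^ ?n"
        using \<epsilon> \<kappa> by (simp add: \<beta>_def flip: power_mult_distrib)
      moreover have "K = ((\<kappa> / 2) powr \<eta> + 3 powr \<eta>) / H * \<epsilon> powr (- \<eta>)"
      proof -
        have "\<alpha> powr \<eta> = (\<kappa> / 2) powr \<eta> * \<epsilon> powr (- \<eta>)"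
        proof -
          have "\<alpha> = \<kappa> / 2 / \<epsilon>" by (simp add: \<alpha>_def)
          then have "\<alpha> powr \<eta> = (\<kappa> / 2) powr \<eta> / \<epsilon> powr \<eta>"
            using \<epsilon> \<kappa> by (simp only: powr_divide)
          then show ?thesis by (simp only: powr_minus_divide) simp
        qed
        moreover have "\<beta> powr \<eta> = 3 powr \<eta> * \<epsilon> powr (- \<eta>)"
          using \<epsilon> by (simp add: \<beta>_def powr_divide powr_minus_divide)
        ultimately show ?thesis by (simp add: K_def distrib_right)
      qed
      moreover have "(7 / (2 * \<epsilon>)) powr l = (7 / 2) powr l * \<epsilon> powr (- l)"
        using \<epsilon> powr_divide[of "7 / 2" \<epsilon> l] by (simp add: powr_minus field_simps)
      moreover have "\<epsilon> powr (- \<eta> - l) = \<epsilon> powr (- \<eta>) * \<epsilon> powr (- l)"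
        by (simp flip: powr_add)
      ultimately show ?thesis by (simp add: X_def m_def mult_ac)
    qed
    also note small
    also have "Y * \<epsilon> powr (- real ?n) = a / 2"
      using \<epsilon> by (simp add: Y_def a_def powr_minus powr_realpow power_mult_distrib power_divide field_simps)
    finally show "2 powr p * (K / H * \<beta> ^ ?n * m) \<le> a / 2" .
  qed
  moreover have "0 < 2 * 2 powr p / a / H" "0 < 2 / \<epsilon>" using pos \<open>0 < H\<close> \<epsilon> by simp_all
  ultimately show ?thesis by metis
qed

theorem theorem1:
  fixes D :: "(real ^ 'n) set" and \<phi> :: "real \<Rightarrow> real" and p H \<eta> \<kappa> :: real
  assumes "0 < p"
    and "0 < H" "H \<le> 1"
    and "0 < \<kappa>" "\<kappa> < 1"
    and "open D" "D \<noteq> {}" "D \<noteq> UNIV" "plump \<kappa> D"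
    and "\<forall>s>0. \<phi> s > 0"
    and "\<phi> \<in> borel_measurable (lebesgue_on {0<..})"
    and "(upper_Assouad_dim (frontier D) < ereal (real CARD('n) - \<eta>) \<and>
            \<not> bounded D \<and> WUSC \<eta> (inverse H) \<phi>) \<or>
         (lower_Assouad_dim (frontier D) > ereal (real CARD('n) - \<eta>) \<and>
            (bounded D \<or> \<not> bounded (frontier D)) \<and> WLSC \<eta> H \<phi>)"
  shows "\<exists>c>0. \<exists>R>0. \<forall>u :: real ^ 'n \<Rightarrow> real.
    u \<in> borel_measurable (lebesgue_on D) \<and>
    (\<integral>\<^sup>+x\<in>D. ennreal (\<bar>u x\<bar> powr p / \<phi> (bdry_dist D x)) \<partial>lebesgue) < \<infinity> \<longrightarrow>
    (\<integral>\<^sup>+x\<in>D. ennreal (\<bar>u x\<bar> powr p / \<phi> (bdry_dist D x)) \<partial>lebesgue)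
      \<le> ennreal c *
        (\<integral>\<^sup>+x\<in>D. (\<integral>\<^sup>+y\<in>D \<inter> ball x (R * bdry_dist D x).
            ennreal (\<bar>u x - u y\<bar> powr p / (\<phi> (bdry_dist D x) * bdry_dist D x ^ CARD('n)))
          \<partial>lebesgue) \<partial>lebesgue)"
proof -
  have "\<exists>c>0. \<exists>R>0. fractional_hardy D p \<phi> c R"
    using assms(12)
  proof
    assume "upper_Assouad_dim (frontier D) < ereal (real CARD('n) - \<eta>) \<and>
            \<not> bounded D \<and> WUSC \<eta> (inverse H) \<phi>"
    then show ?thesis using assms(1-10) by (intro fractional_hardy_thin[of D \<kappa> p H \<phi> \<eta>]) auto
  next
    assume "lower_Assouad_dim (frontier D) > ereal (real CARD('n) - \<eta>) \<and>
            (bounded D \<or> \<not> bounded (frontier D)) \<and> WLSC \<eta> H \<phi>"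
    then show ?thesis using assms(1-10) by (intro fractional_hardy_thick[of D \<kappa> p H \<phi> \<eta>]) auto
  qed
  then show ?thesis by (simp add: fractional_hardy_def)
qed

end
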